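(* Let $0<\alpha<1$ and let $\theta(x,t)$, $x\in\mathbb{R}^d$, $t\ge0$, be a smooth solution, periodic in $x$, of the active scalar equation $\theta_t=(u\cdot\nabla)\theta-(-\Delta)^\alpha\theta$, where $u$ is determined from $\theta$. Suppose that $\omega(\xi,t)$ is continuous in $(\xi,t)$, piecewise $C^1$ in $t$ for each fixed $\xi$, that for every $t\ge0$ the function $\omega(\cdot,t)$ is a modulus of continuity, and that $\partial^2_{\xi\xi}\omega(0,t)=-\infty$ for all $t\ge0$. Let $t_1>0$ and $x\ne y$ be such that $\theta(\cdot,t)$ obeys $\omega(\cdot,t)$ for all $t<t_1$ and $\theta(x,t_1)-\theta(y,t_1)=\omega(\xi,t_1)$, where $\xi=|x-y|$. Then $$-(-\Delta)^\alpha\theta(x,t_1)+(-\Delta)^\alpha\theta(y,t_1)\le D_{\alpha,\omega}(\xi,t_1).$$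
   Context: A modulus of continuity is a function $\omega:\mathbb{R}^+\to\mathbb{R}^+$ with $\omega(0)=0$ that is continuous, increasing, concave, and piecewise $C^1$ on $(0,\infty)$ (its derivative is continuous except perhaps at finitely many points, where one-sided derivatives exist but may differ). A function $f$ obeys $\omega$ if $|f(x)-f(y)|<\omega(|x-y|)$ for all $x\ne y$. The condition $\partial^2_{\xi\xi}\omega(0,t)=-\infty$ means that $\partial^2_{\xi\xi}\omega(\xi,t)\to-\infty$ as $\xi\to0^+$. Dissipation term: $D_{\alpha,\omega}(\xi,t)$ is, for $\omega=\omega(\cdot,t)$, $$D_{\alpha,\omega}(\xi)=c_\alpha\left(\int_0^{\xi/2}\frac{\omega(\xi+2\eta)+\omega(\xi-2\eta)-2\omega(\xi)}{\eta^{1+2\alpha}}\,d\eta+\int_{\xi/2}^\infty\frac{\omega(2\eta+\xi)-\omega(2\eta-\xi)-2\omega(\xi)}{\eta^{1+2\alpha}}\,d\eta\right),$$ where both integrands are nonpositive by concavity. Here $0<c_\alpha<1$ is a fixed constant such that the kernel $\Phi^\alpha_{1,t}$ of $e^{-t(-\Delta)^\alpha}$ on $\mathbb{R}$ satisfies $c_\alpha\min\left(t^{-1/(2\alpha)},\,t|x|^{-1-2\alpha}\right)\le\Phi^\alpha_{1,t}(x)\le c_\alpha^{-1}\min\left(t^{-1/(2\alpha)},\,t|x|^{-1-2\alpha}\right)$ for all $x\in\mathbb{R}$, $t>0$. *)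

theory Defs
  imports "HOL-Analysis.Analysis"
begin

text \<open>Smoothness on a set with boundary. Derivatives are taken within the set, so on
  \<open>\<real>\<^sup>d \<times> [0,\<infinity>)\<close> this is smoothness up to \<open>t = 0\<close>; \<open>f' b\<close> is the partial derivative of
  \<open>f\<close> in the direction \<open>b\<close>.\<close>

primrec Ck_on :: "nat \<Rightarrow> 'a::euclidean_space set \<Rightarrow> ('a \<Rightarrow> real) \<Rightarrow> bool" where
  "Ck_on 0 S f \<longleftrightarrow> continuous_on S f"
| "Ck_on (Suc k) S f \<longleftrightarrow>
     (\<exists>f'. (\<forall>z\<in>S. (f has_derivative (\<lambda>h. \<Sum>b\<in>Basis. f' b z * (h \<bullet> b))) (at z within S)) \<and>
           (\<forall>b\<in>Basis. Ck_on k S (f' b)))"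

definition smooth_on :: "'a::euclidean_space set \<Rightarrow> ('a \<Rightarrow> real) \<Rightarrow> bool" where
  "smooth_on S f \<longleftrightarrow> (\<forall>k. Ck_on k S f)"

text \<open>At an endpoint of \<open>A\<close> belonging to \<open>A\<close>, one of the two one-sided conditions is vacuous.
  The library's \<open>piecewise_C1_differentiable_on\<close> does not ask for one-sided derivatives.\<close>

definition piecewise_C1_on :: "real set \<Rightarrow> (real \<Rightarrow> real) \<Rightarrow> bool" where
  "piecewise_C1_on A f \<longleftrightarrow>
     (\<exists>S. finite S \<and> S \<subseteq> A \<and> f C1_differentiable_on (A - S) \<and>
        (\<forall>s\<in>S. f differentiable (at s within A \<inter> {..s}) \<and>
               f differentiable (at s within A \<inter> {s..})))"

text \<open>A modulus of continuity is defined on \<open>[0,\<infinity>)\<close>; its values at negative arguments are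
  irrelevant. ``Increasing'' is read in the wide sense.\<close>

definition modulus_of_continuity :: "(real \<Rightarrow> real) \<Rightarrow> bool" where
  "modulus_of_continuity \<omega> \<longleftrightarrow>
     (\<forall>\<xi>\<ge>0. 0 \<le> \<omega> \<xi>) \<and> \<omega> 0 = 0 \<and> continuous_on {0..} \<omega> \<and> mono_on {0..} \<omega> \<and>
     concave_on {0..} \<omega> \<and> piecewise_C1_on {0<..} \<omega>"

definition obeys :: "('a::real_normed_vector \<Rightarrow> real) \<Rightarrow> (real \<Rightarrow> real) \<Rightarrow> bool" where
  "obeys f \<omega> \<longleftrightarrow> (\<forall>x y. x \<noteq> y \<longrightarrow> \<bar>f x - f y\<bar> < \<omega> (norm (x - y)))"

text \<open>\<open>g''(\<xi>) \<rightarrow> -\<infinity>\<close> as \<open>\<xi> \<rightarrow> 0+\<close>. Since \<open>deriv\<close> is total, the existence of the second derivative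
  near \<open>0\<close> is stated explicitly.\<close>

definition second_deriv_minus_infinity_at_0 :: "(real \<Rightarrow> real) \<Rightarrow> bool" where
  "second_deriv_minus_infinity_at_0 g \<longleftrightarrow>
     (\<forall>\<^sub>F \<xi> in at_right 0. g differentiable (at \<xi>) \<and> deriv g differentiable (at \<xi>)) \<and>
     filterlim (deriv (deriv g)) at_bot (at_right 0)"

text \<open>The operator \<open>(-\<Delta>)\<^sup>\<alpha>\<close> on functions on \<open>\<real>\<^sup>d\<close> that are \<open>L\<close>-periodic in each coordinate: the
  Fourier multiplier \<open>\<bar>2\<pi>k/L\<bar>\<close> to the power \<open>2\<alpha>\<close>. For smooth \<open>f\<close> the series
  converges absolutely and its sum is real.\<close>

definition periodic :: "real \<Rightarrow> (real ^ 'd \<Rightarrow> real) \<Rightarrow> bool" where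
  "periodic L f \<longleftrightarrow> (\<forall>x i. f (x + axis i L) = f x)"

definition fourier_coeff :: "real \<Rightarrow> (real ^ 'd \<Rightarrow> real) \<Rightarrow> real ^ 'd \<Rightarrow> complex" where
  "fourier_coeff L f k =
     complex_of_real (1 / L ^ CARD('d)) *
     (LINT y:cbox 0 (\<chi> i. L)|lborel. complex_of_real (f y) * cis (- (2 * pi / L) * (k \<bullet> y)))"

definition frac_laplacian :: "real \<Rightarrow> real \<Rightarrow> (real ^ 'd \<Rightarrow> real) \<Rightarrow> real ^ 'd \<Rightarrow> real" where
  "frac_laplacian L \<alpha> f x =
     Re (\<Sum>\<^sub>\<infinity>k\<in>{k. \<forall>i. k $ i \<in> \<int>}.
           complex_of_real ((2 * pi * norm k / L) powr (2 * \<alpha>)) *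
           fourier_coeff L f k * cis ((2 * pi / L) * (k \<bullet> x)))"

text \<open>The convolution kernel of the semigroup generated by \<open>-(-\<Delta>)\<^sup>\<alpha>\<close> on the real line.\<close>

definition frac_heat_kernel :: "real \<Rightarrow> real \<Rightarrow> real \<Rightarrow> real" where
  "frac_heat_kernel \<alpha> t x =
     Re (complex_of_real (1 / (2 * pi)) *
         (LINT k|lborel. cis (k * x) * complex_of_real (exp (- t * \<bar>k\<bar> powr (2 * \<alpha>)))))"

text \<open>The minimum of \<open>t\<close> to the power \<open>-1/(2\<alpha>)\<close> and \<open>t\<close> times \<open>\<bar>x\<bar>\<close> to the power \<open>-1-2\<alpha>\<close>.
  The case \<open>x = 0\<close>, where the second term is infinite, is separate because \<open>0 powr a = 0\<close>.\<close>

definition kernel_profile :: "real \<Rightarrow> real \<Rightarrow> real \<Rightarrow> real" where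
  "kernel_profile \<alpha> t x =
     (if x = 0 then t powr (- 1 / (2 * \<alpha>))
      else min (t powr (- 1 / (2 * \<alpha>))) (t * \<bar>x\<bar> powr (- 1 - 2 * \<alpha>)))"

definition kernel_constant :: "real \<Rightarrow> real \<Rightarrow> bool" where
  "kernel_constant \<alpha> c \<longleftrightarrow> 0 < c \<and> c < 1 \<and>
     (\<forall>x. \<forall>t>0. c * kernel_profile \<alpha> t x \<le> frac_heat_kernel \<alpha> t x \<and>
                frac_heat_kernel \<alpha> t x \<le> inverse c * kernel_profile \<alpha> t x)"

text \<open>The integral over \<open>A\<close> of a function that is nonpositive on \<open>A\<close>, with values in \<open>[-\<infinity>,0]\<close>.
  The dissipation term is extended-valued because its integrals may diverge to \<open>-\<infinity>\<close>, for
  instance at a corner of \<open>\<omega>\<close> when \<open>\<alpha> \<ge> 1/2\<close>, where the Bochner integral would be \<open>0\<close>.\<close>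

definition nonpos_integral :: "real set \<Rightarrow> (real \<Rightarrow> real) \<Rightarrow> ereal" where
  "nonpos_integral A g = - enn2ereal (\<integral>\<^sup>+\<eta>\<in>A. ennreal (- g \<eta>) \<partial>lborel)"

definition dissipation :: "real \<Rightarrow> real \<Rightarrow> (real \<Rightarrow> real) \<Rightarrow> real \<Rightarrow> ereal" where
  "dissipation c \<alpha> \<omega> \<xi> = ereal c *
     (nonpos_integral {0..\<xi> / 2}
        (\<lambda>\<eta>. (\<omega> (\<xi> + 2 * \<eta>) + \<omega> (\<xi> - 2 * \<eta>) - 2 * \<omega> \<xi>) / \<eta> powr (1 + 2 * \<alpha>)) +
      nonpos_integral {\<xi> / 2..}
        (\<lambda>\<eta>. (\<omega> (2 * \<eta> + \<xi>) - \<omega> (2 * \<eta> - \<xi>) - 2 * \<omega> \<xi>) / \<eta> powr (1 + 2 * \<alpha>)))"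

text \<open>The velocity \<open>u = U \<theta>\<close> is given by an arbitrary operator \<open>U\<close>; at \<open>t = 0\<close> the time
  derivative is one-sided. The Frechet derivative in \<open>x\<close> applied to \<open>u\<close> is \<open>(u \<cdot> \<nabla>)\<theta>\<close>.\<close>

definition smooth_periodic_solution ::
  "real \<Rightarrow> real \<Rightarrow> ((real ^ 'd \<Rightarrow> real \<Rightarrow> real) \<Rightarrow> real ^ 'd \<Rightarrow> real \<Rightarrow> real ^ 'd) \<Rightarrow>
   (real ^ 'd \<Rightarrow> real \<Rightarrow> real) \<Rightarrow> bool" where
  "smooth_periodic_solution L \<alpha> U \<theta> \<longleftrightarrow>
     smooth_on (UNIV \<times> {0..}) (\<lambda>(x, t). \<theta> x t) \<and>
     (\<forall>t\<ge>0. periodic L (\<lambda>x. \<theta> x t)) \<and>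
     (\<forall>x. \<forall>t\<ge>0. ((\<lambda>s. \<theta> x s) has_real_derivative
        frechet_derivative (\<lambda>z. \<theta> z t) (at x) (U \<theta> x t) - frac_laplacian L \<alpha> (\<lambda>z. \<theta> z t) x)
        (at t within {0..}))"

end

theory Submission
  imports Defs "HOL-Probability.Probability"
begin

text \<open>
  Let \<open>N\<close> be a standard normal variable, \<open>\<nu>\<close> the measure with density \<open>|s|\<close> to the power \<open>-1-2\<alpha>\<close>
  on the line, \<open>K = \<integral> (1 - exp (-s\<^sup>2/2)) d\<nu>\<close> and \<open>m = E |N|\<close> to the power \<open>2\<alpha>\<close>. By scaling,
  the symbol \<open>|k|\<close> to the power \<open>2\<alpha>\<close> is \<open>1/K\<close> times \<open>\<integral> (1 - exp (-(s|k|)\<^sup>2/2)) d\<nu>\<close>, so the fractional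
  Laplacian is subordinated to the Gaussian semigroup. At the touching time
  the solution still obeys the modulus with \<open>\<le>\<close>. Reflecting in the hyperplane that bisects the
  segment between \<open>x\<close> and \<open>y\<close> reduces the difference of the Gaussian averages at these points to one
  dimension, where it falls short of \<open>\<omega>(\<xi>)\<close> by at least half the Gaussian average of the second
  difference of the odd extension of \<open>\<omega>\<close>. Integrating against \<open>\<nu>\<close> gives the dissipation with
  constant \<open>m/K\<close> in place of \<open>c\<close>. Finally \<open>c K \<le> m\<close>: pair the heat kernel with
  \<open>exp (-(ax)\<^sup>2/2) - exp (-x\<^sup>2/2)\<close>, divide by the time \<open>t\<close> and let \<open>a\<close> and \<open>t\<close> tend to \<open>0\<close>. The pairing is
  at most \<open>t m\<close> by Fourier duality, and at least \<open>c\<close> times the pairing with the profile.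
\<close>

section \<open>The constant of the subordination formula\<close>

definition levy_measure :: "real \<Rightarrow> real measure" where
  "levy_measure \<alpha> = density lborel (\<lambda>s. ennreal (\<bar>s\<bar> powr (- 1 - 2 * \<alpha>)))"

definition gauss_gap :: "real \<Rightarrow> ennreal" where
  "gauss_gap \<alpha> = (\<integral>\<^sup>+s. ennreal (1 - exp (- s\<^sup>2 / 2)) \<partial>levy_measure \<alpha>)"

definition gauss_moment :: "real \<Rightarrow> ennreal" where
  "gauss_moment \<alpha> = (\<integral>\<^sup>+n. ennreal (\<bar>n\<bar> powr (2 * \<alpha>)) \<partial>std_normal_distribution)"

lemma space_levy_measure [simp]: "space (levy_measure \<alpha>) = UNIV"
  and sets_levy_measure [simp, measurable_cong]: "sets (levy_measure \<alpha>) = sets borel"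
  by (simp_all add: levy_measure_def)

lemma nn_integral_levy_measure:
  assumes "h \<in> borel_measurable borel"
  shows "(\<integral>\<^sup>+s. h s \<partial>levy_measure \<alpha>) = (\<integral>\<^sup>+s. ennreal (\<bar>s\<bar> powr (- 1 - 2 * \<alpha>)) * h s \<partial>lborel)"
  using assms unfolding levy_measure_def by (subst nn_integral_density) auto

lemma sigma_finite_levy_measure: "sigma_finite_measure (levy_measure \<alpha>)"
  unfolding levy_measure_def
  by (subst sigma_finite_measure.sigma_finite_iff_density_finite) (auto intro: lborel.sigma_finite_measure_axioms)

lemma nn_integral_levy_measure_scale:
  fixes h :: "real \<Rightarrow> ennreal"
  assumes [measurable]: "h \<in> borel_measurable borel" and "h 0 = 0"
  shows "(\<integral>\<^sup>+s. h (s * l) \<partial>levy_measure \<alpha>) = ennreal (\<bar>l\<bar> powr (2 * \<alpha>)) * (\<integral>\<^sup>+s. h s \<partial>levy_measure \<alpha>)"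
proof (cases "l = 0")
  case True
  then show ?thesis using assms by simp
next
  case False
  have pw: "\<bar>l\<bar> powr (2 * \<alpha>) * \<bar>l\<bar> * \<bar>l * s\<bar> powr (- 1 - 2 * \<alpha>) = \<bar>s\<bar> powr (- 1 - 2 * \<alpha>)" for s
  proof -
    have "\<bar>l\<bar> powr (2 * \<alpha>) * \<bar>l\<bar> powr 1 * \<bar>l\<bar> powr (- 1 - 2 * \<alpha>) = 1"
      unfolding powr_add[symmetric] using False by simp
    then show ?thesis
      using False by (simp add: abs_mult powr_mult flip: mult.assoc)
  qed
  have "(\<integral>\<^sup>+s. h s \<partial>levy_measure \<alpha>) = (\<integral>\<^sup>+s. ennreal (\<bar>s\<bar> powr (- 1 - 2 * \<alpha>)) * h s \<partial>lborel)"
    by (simp add: nn_integral_levy_measure)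
  also have "\<dots> = ennreal \<bar>l\<bar> * (\<integral>\<^sup>+s. ennreal (\<bar>l * s\<bar> powr (- 1 - 2 * \<alpha>)) * h (l * s) \<partial>lborel)"
    using False by (subst nn_integral_real_affine[where c = l and t = 0]) auto
  finally have "ennreal (\<bar>l\<bar> powr (2 * \<alpha>)) * (\<integral>\<^sup>+s. h s \<partial>levy_measure \<alpha>) =
      (\<integral>\<^sup>+s. ennreal (\<bar>l\<bar> powr (2 * \<alpha>)) * (ennreal \<bar>l\<bar> * (ennreal (\<bar>l * s\<bar> powr (- 1 - 2 * \<alpha>)) * h (l * s))) \<partial>lborel)"
    by (simp add: nn_integral_cmult)
  also have "\<dots> = (\<integral>\<^sup>+s. ennreal (\<bar>s\<bar> powr (- 1 - 2 * \<alpha>)) * h (s * l) \<partial>lborel)"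
    using pw by (intro nn_integral_cong) (simp add: mult.commute[of l] flip: mult.assoc ennreal_mult')
  also have "\<dots> = (\<integral>\<^sup>+s. h (s * l) \<partial>levy_measure \<alpha>)"
    by (simp add: nn_integral_levy_measure)
  finally show ?thesis ..
qed

lemma nn_integral_levy_gauss_scale:
  assumes [measurable]: "h \<in> borel_measurable borel" and "h 0 = 0"
  shows "(\<integral>\<^sup>+s. \<integral>\<^sup>+n. h (s * n) \<partial>std_normal_distribution \<partial>levy_measure \<alpha>) =
    gauss_moment \<alpha> * (\<integral>\<^sup>+s. h s \<partial>levy_measure \<alpha>)"
proof -
  interpret N: prob_space std_normal_distribution by (rule prob_space_normal_density) simp
  interpret V: sigma_finite_measure "levy_measure \<alpha>" by (rule sigma_finite_levy_measure)
  interpret P: pair_sigma_finite "levy_measure \<alpha>" std_normal_distribution ..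
  have "(\<integral>\<^sup>+s. \<integral>\<^sup>+n. h (s * n) \<partial>std_normal_distribution \<partial>levy_measure \<alpha>) =
      (\<integral>\<^sup>+n. \<integral>\<^sup>+s. h (s * n) \<partial>levy_measure \<alpha> \<partial>std_normal_distribution)"
    by (rule P.Fubini'[symmetric]) measurable
  also have "\<dots> = (\<integral>\<^sup>+n. ennreal (\<bar>n\<bar> powr (2 * \<alpha>)) * (\<integral>\<^sup>+s. h s \<partial>levy_measure \<alpha>) \<partial>std_normal_distribution)"
    using assms by (simp add: nn_integral_levy_measure_scale)
  finally show ?thesis by (simp add: nn_integral_multc gauss_moment_def)
qed

lemma gauss_gap_scale:
  "(\<integral>\<^sup>+s. ennreal (1 - exp (- (s * l)\<^sup>2 / 2)) \<partial>levy_measure \<alpha>) = ennreal (\<bar>l\<bar> powr (2 * \<alpha>)) * gauss_gap \<alpha>"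
  using nn_integral_levy_measure_scale[of "\<lambda>s. ennreal (1 - exp (- s\<^sup>2 / 2))" \<alpha> l]
  by (simp add: gauss_gap_def)

lemma gauss_gap_pos: "0 < gauss_gap \<alpha>"
proof (rule ccontr)
  assume "\<not> 0 < gauss_gap \<alpha>"
  then have "AE s in lborel. ennreal (\<bar>s\<bar> powr (- 1 - 2 * \<alpha>)) * ennreal (1 - exp (- s\<^sup>2 / 2)) = 0"
    by (simp add: gauss_gap_def nn_integral_levy_measure nn_integral_0_iff_AE)
  then have "AE s in lborel. s = (0::real)"
    by (rule AE_mp) (auto intro!: AE_I2 simp flip: ennreal_mult')
  moreover have "AE s in lborel. s \<noteq> (0::real)" by (rule AE_lborel_singleton)
  ultimately have "AE s in lborel. \<not> (s = s + (0::real))"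
    by eventually_elim simp
  then show False by (simp add: eventually_False ae_filter_eq_bot_iff)
qed

lemma powr_le_one_plus_square:
  fixes s :: real
  assumes "0 < \<alpha>" "\<alpha> < 1"
  shows "\<bar>s\<bar> powr (2 * \<alpha>) \<le> 1 + s\<^sup>2"
proof (cases "\<bar>s\<bar> \<le> 1")
  case True
  then have "\<bar>s\<bar> powr (2 * \<alpha>) \<le> 1 powr (2 * \<alpha>)" using assms by (intro powr_mono2) auto
  then show ?thesis by (simp add: add_increasing2)
next
  case False
  then have "\<bar>s\<bar> powr (2 * \<alpha>) \<le> \<bar>s\<bar> powr 2" using assms by (intro powr_mono) auto
  then show ?thesis using False by (simp add: powr_realpow)
qed

lemma gauss_moment_finite:
  assumes "0 < \<alpha>" "\<alpha> < 1"
  shows "gauss_moment \<alpha> < \<infinity>"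
proof -
  have "gauss_moment \<alpha> \<le> (\<integral>\<^sup>+n. ennreal (1 + n ^ 2) \<partial>std_normal_distribution)"
    unfolding gauss_moment_def
    by (intro nn_integral_mono ennreal_leI powr_le_one_plus_square assms)
  also have "\<dots> < \<infinity>"
  proof -
    interpret N: prob_space std_normal_distribution by (rule prob_space_normal_density) simp
    have "integrable std_normal_distribution (\<lambda>n. 1 + n ^ 2)"
      by (intro Bochner_Integration.integrable_add integrable_std_normal_distribution_moment) simp
    then have "(\<integral>\<^sup>+n. ennreal (norm (1 + n ^ 2)) \<partial>std_normal_distribution) < \<infinity>"
      unfolding integrable_iff_bounded by blast
    then show ?thesis by simp
  qed
  finally show ?thesis .
qed

lemma gauss_cis: "(CLINT n|std_normal_distribution. cis (u * n)) = complex_of_real (exp (- u\<^sup>2 / 2))"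
  using fun_cong[OF char_std_normal_distribution, of u] by (simp add: char_def cis_conv_exp mult.commute)

lemma gauss_cos: "(LINT n|std_normal_distribution. cos (u * n)) = exp (- u\<^sup>2 / 2)"
proof -
  interpret N: prob_space std_normal_distribution by (rule prob_space_normal_density) simp
  have "integrable std_normal_distribution (\<lambda>n. cis (u * n))"
    by (rule N.integrable_const_bound[where B = 1]) (auto simp: cis_conv_exp)
  from integral_Re[OF this] show ?thesis by (simp add: gauss_cis)
qed

context
  fixes \<alpha> c :: real
  assumes alpha: "0 < \<alpha>" and kc: "kernel_constant \<alpha> c"
begin

text \<open>If this failed, the Bochner integral defining the kernel at \<open>x = 0\<close> would be \<open>0\<close>, against
  the lower bound of the kernel.\<close>

private lemma symbol_integrable:
  assumes "0 < t"
  shows "integrable lborel (\<lambda>k. exp (- t * \<bar>k\<bar> powr (2 * \<alpha>)))"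
proof (rule ccontr)
  assume "\<not> ?thesis"
  then have "frac_heat_kernel \<alpha> t 0 = 0"
    by (simp add: frac_heat_kernel_def not_integrable_integral_eq)
  moreover have "0 < c * kernel_profile \<alpha> t 0"
    using kc assms by (simp add: kernel_constant_def kernel_profile_def)
  ultimately show False
    using kc assms unfolding kernel_constant_def by (metis not_less)
qed

private lemma kernel_cos:
  assumes "0 < t"
  shows "frac_heat_kernel \<alpha> t x = 1 / (2 * pi) * (LINT k|lborel. cos (k * x) * exp (- t * \<bar>k\<bar> powr (2 * \<alpha>)))"
proof -
  have "integrable lborel (\<lambda>k. cis (k * x) * complex_of_real (exp (- t * \<bar>k\<bar> powr (2 * \<alpha>))))"
    by (rule Bochner_Integration.integrable_bound[OF symbol_integrable[OF assms]])
       (auto simp: norm_mult cis_conv_exp)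
  from integral_Re[OF this] show ?thesis
    by (simp add: frac_heat_kernel_def)
qed

private lemma kernel_gauss:
  assumes "0 < t" "0 < a"
  shows "has_bochner_integral lborel (\<lambda>x. frac_heat_kernel \<alpha> t x * exp (- (a * x)\<^sup>2 / 2))
    (LINT n|std_normal_distribution. exp (- t * \<bar>a * n\<bar> powr (2 * \<alpha>)))"
proof -
  let ?P = "\<lambda>k. exp (- t * \<bar>k\<bar> powr (2 * \<alpha>))"
  let ?G = "\<lambda>x::real. exp (- (a * x)\<^sup>2 / 2)"
  have G: "?G x = sqrt (2 * pi) * std_normal_density (a * x)" for x
    by (simp add: std_normal_density_def)
  have "integrable lborel (\<lambda>x. std_normal_density (0 + a * x))"
    using \<open>0 < a\<close> by (intro lborel_integrable_real_affine) auto
  then have intG: "integrable lborel ?G"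
    unfolding G add_0 by (rule integrable_mult_right)
  note intP = symbol_integrable[OF \<open>0 < t\<close>]
  let ?F = "\<lambda>(x, k). 1 / (2 * pi) * (cos (k * x) * ?P k * ?G x)"
  have "integrable (lborel \<Otimes>\<^sub>M lborel) (\<lambda>(x, k). ?G x * ?P k)"
    by (rule lborel_pair.Fubini_integrable) (use intG intP in \<open>auto simp: case_prod_beta abs_mult\<close>)
  then have F: "integrable (lborel \<Otimes>\<^sub>M lborel) ?F"
    by (rule Bochner_Integration.integrable_bound[OF integrable_mult_right[where c = "1 / (2 * pi)"]])
       (auto simp: case_prod_beta abs_mult mult_left_le_one_le divide_right_mono intro!: AE_I2 mult_mono)
  have inner: "(LINT x|lborel. ?F (x, k)) = ?P k * ((1 / a) * std_normal_density (k / a))" for k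
  proof -
    have "exp (- (k / a)\<^sup>2 / 2) = (LINT x|lborel. std_normal_density x * cos (k / a * x))"
      by (subst gauss_cos[symmetric], subst integral_density) auto
    also have "\<dots> = a * (LINT x|lborel. std_normal_density (a * x) * cos (k / a * (a * x)))"
      using lborel_integral_real_affine[of a "\<lambda>x. std_normal_density x * cos (k / a * x)" 0] \<open>0 < a\<close> by simp
    also have "\<dots> = a * (LINT x|lborel. std_normal_density (a * x) * cos (k * x))"
      using \<open>0 < a\<close> by simp
    finally have *: "(LINT x|lborel. std_normal_density (a * x) * cos (k * x)) = exp (- (k / a)\<^sup>2 / 2) / a"
      using \<open>0 < a\<close> by (simp add: field_simps)
    have "(LINT x|lborel. ?F (x, k)) =
        (LINT x|lborel. (1 / (2 * pi) * ?P k * sqrt (2 * pi)) * (std_normal_density (a * x) * cos (k * x)))"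
      unfolding G prod.case by (intro Bochner_Integration.integral_cong) (auto simp: algebra_simps)
    also have "\<dots> = (1 / (2 * pi) * ?P k * sqrt (2 * pi)) * (exp (- (k / a)\<^sup>2 / 2) / a)"
      by (subst integral_mult_right_zero) (simp only: *)
    also have "\<dots> = ?P k * ((1 / a) * std_normal_density (k / a))"
    proof -
      have "1 / (2 * pi) * sqrt (2 * pi) = 1 / sqrt (2 * pi)"
        using sqrt_divide_self_eq[of "2 * pi"] by (simp add: divide_simps)
      then have "(1 / (2 * pi) * sqrt (2 * pi)) * (?P k * (exp (- (k / a)\<^sup>2 / 2) / a)) =
          (1 / sqrt (2 * pi)) * (?P k * (exp (- (k / a)\<^sup>2 / 2) / a))"
        by (simp only:)
      then show ?thesis
        by (simp add: std_normal_density_def mult_ac)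
    qed
    finally show ?thesis .
  qed
  have outer: "(LINT k|lborel. ?F (x, k)) = frac_heat_kernel \<alpha> t x * ?G x" for x
    unfolding kernel_cos[OF \<open>0 < t\<close>] by (simp add: mult.assoc[symmetric])
  have "integrable lborel (\<lambda>x. LINT k|lborel. ?F (x, k))"
    using lborel_pair.integrable_fst'[OF F] .
  moreover have "(LINT x|lborel. LINT k|lborel. ?F (x, k)) = (LINT k|lborel. LINT x|lborel. ?F (x, k))"
    using lborel_pair.Fubini_integral[of "\<lambda>x k. ?F (x, k)"] F by (simp add: case_prod_beta)
  moreover have "(LINT k|lborel. LINT x|lborel. ?F (x, k)) =
      (LINT n|std_normal_distribution. exp (- t * \<bar>a * n\<bar> powr (2 * \<alpha>)))"
  proof -
    have "(LINT k|lborel. LINT x|lborel. ?F (x, k)) =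
       a * (LINT n|lborel. ?P (a * n) * ((1 / a) * std_normal_density (a * n / a)))"
      unfolding inner
      using lborel_integral_real_affine[of a "\<lambda>k. ?P k * ((1 / a) * std_normal_density (k / a))" 0] \<open>0 < a\<close> by simp
    also have "\<dots> = (LINT n|lborel. std_normal_density n * ?P (a * n))"
      using \<open>0 < a\<close> by (subst integral_mult_right_zero[symmetric]) (simp add: mult.commute)
    also have "\<dots> = (LINT n|std_normal_distribution. exp (- t * \<bar>a * n\<bar> powr (2 * \<alpha>)))"
      by (subst integral_density) auto
    finally show ?thesis .
  qed
  ultimately show ?thesis
    unfolding outer by (simp add: has_bochner_integral_iff)
qed

private lemma kernel_profile_bound:
  assumes "0 < t" "0 < a" "a \<le> 1"
  shows "(\<integral>\<^sup>+x. ennreal (c * (kernel_profile \<alpha> t x / t) * (exp (- (a * x)\<^sup>2 / 2) - exp (- x\<^sup>2 / 2))) \<partial>lborel)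
    \<le> gauss_moment \<alpha>"
proof -
  interpret N: prob_space std_normal_distribution by (rule prob_space_normal_density) simp
  have expint: "integrable std_normal_distribution (\<lambda>n. exp (- t * \<bar>b * n\<bar> powr (2 * \<alpha>)))" for b
    using \<open>0 < t\<close> by (intro N.integrable_const_bound[where B = 1]) auto
  have gap: "0 \<le> exp (- (a * x)\<^sup>2 / 2) - exp (- x\<^sup>2 / 2)" for x
    using assms by (auto simp: power_mult_distrib mult_left_le_one_le power_le_one)
  have hb: "has_bochner_integral lborel (\<lambda>x. frac_heat_kernel \<alpha> t x * (exp (- (a * x)\<^sup>2 / 2) - exp (- x\<^sup>2 / 2)) / t)
     (((LINT n|std_normal_distribution. exp (- t * \<bar>a * n\<bar> powr (2 * \<alpha>))) -
        (LINT n|std_normal_distribution. exp (- t * \<bar>n\<bar> powr (2 * \<alpha>)))) / t)"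
    using has_bochner_integral_divide_zero[OF has_bochner_integral_diff[OF
      kernel_gauss[OF \<open>0 < t\<close> \<open>0 < a\<close>] kernel_gauss[OF \<open>0 < t\<close>, of 1]]]
    by (simp add: right_diff_distrib)
  have prof: "0 \<le> kernel_profile \<alpha> t x" for x
    using assms by (simp add: kernel_profile_def)
  have ker: "c * kernel_profile \<alpha> t x \<le> frac_heat_kernel \<alpha> t x" for x
    using kc \<open>0 < t\<close> by (simp add: kernel_constant_def)
  have "0 < c" using kc by (simp add: kernel_constant_def)
  then have ker0: "0 \<le> frac_heat_kernel \<alpha> t x" for x
    using order.trans[OF mult_nonneg_nonneg ker] prof by simp
  have "(\<integral>\<^sup>+x. ennreal (c * (kernel_profile \<alpha> t x / t) * (exp (- (a * x)\<^sup>2 / 2) - exp (- x\<^sup>2 / 2))) \<partial>lborel) \<le>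
      (\<integral>\<^sup>+x. ennreal (frac_heat_kernel \<alpha> t x * (exp (- (a * x)\<^sup>2 / 2) - exp (- x\<^sup>2 / 2)) / t) \<partial>lborel)"
    using ker gap \<open>0 < t\<close>
    by (intro nn_integral_mono ennreal_leI) (auto intro!: divide_right_mono mult_right_mono)
  also have "\<dots> = ennreal (((LINT n|std_normal_distribution. exp (- t * \<bar>a * n\<bar> powr (2 * \<alpha>))) -
        (LINT n|std_normal_distribution. exp (- t * \<bar>n\<bar> powr (2 * \<alpha>)))) / t)"
    using hb gap ker0 \<open>0 < t\<close> unfolding has_bochner_integral_iff
    by (subst nn_integral_eq_integral) auto
  also have "\<dots> \<le> ennreal (LINT n|std_normal_distribution. (1 - exp (- t * \<bar>n\<bar> powr (2 * \<alpha>))) / t)"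
  proof (rule ennreal_leI)
    have "(LINT n|std_normal_distribution. exp (- t * \<bar>a * n\<bar> powr (2 * \<alpha>))) \<le> (LINT n|std_normal_distribution. 1)"
      using expint \<open>0 < t\<close> by (intro integral_mono) auto
    then show "((LINT n|std_normal_distribution. exp (- t * \<bar>a * n\<bar> powr (2 * \<alpha>))) -
        (LINT n|std_normal_distribution. exp (- t * \<bar>n\<bar> powr (2 * \<alpha>)))) / t
        \<le> (LINT n|std_normal_distribution. (1 - exp (- t * \<bar>n\<bar> powr (2 * \<alpha>))) / t)"
      using expint[of 1] \<open>0 < t\<close> by (simp add: N.prob_space divide_right_mono)
  qed
  also have "\<dots> = (\<integral>\<^sup>+n. ennreal ((1 - exp (- t * \<bar>n\<bar> powr (2 * \<alpha>))) / t) \<partial>std_normal_distribution)"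
    using expint[of 1] \<open>0 < t\<close> by (subst nn_integral_eq_integral) auto
  also have "\<dots> \<le> gauss_moment \<alpha>"
    unfolding gauss_moment_def
  proof (rule nn_integral_mono, rule ennreal_leI)
    fix n :: real
    have "1 - exp (- t * \<bar>n\<bar> powr (2 * \<alpha>)) \<le> t * \<bar>n\<bar> powr (2 * \<alpha>)"
      using exp_ge_add_one_self[of "- t * \<bar>n\<bar> powr (2 * \<alpha>)"] by simp
    then show "(1 - exp (- t * \<bar>n\<bar> powr (2 * \<alpha>))) / t \<le> \<bar>n\<bar> powr (2 * \<alpha>)"
      using \<open>0 < t\<close> by (simp add: field_simps)
  qed
  finally show ?thesis .
qed

lemma kernel_constant_le: "ennreal c * gauss_gap \<alpha> \<le> gauss_moment \<alpha>"
proof -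
  let ?h = "\<lambda>n x. c * (kernel_profile \<alpha> (1 / real (Suc n)) x / (1 / real (Suc n))) *
      (exp (- (1 / real (Suc n) * x)\<^sup>2 / 2) - exp (- x\<^sup>2 / 2))"
  have "0 < c" using kc by (simp add: kernel_constant_def)
  have lim: "(\<lambda>n. ennreal (?h n x)) \<longlonglongrightarrow> ennreal (c * (\<bar>x\<bar> powr (- 1 - 2 * \<alpha>) * (1 - exp (- x\<^sup>2 / 2))))"
    if "x \<noteq> 0" for x
  proof (rule tendsto_ennrealI)
    have "filterlim (\<lambda>n. real (Suc n) powr (1 / (2 * \<alpha>) + 1)) at_top sequentially"
    proof (rule filterlim_at_top_mono)
      show "filterlim (\<lambda>n. real (Suc n)) at_top sequentially"
        by (intro filterlim_compose[OF filterlim_real_sequentially filterlim_Suc])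
      have "real (Suc n) powr 1 \<le> real (Suc n) powr (1 / (2 * \<alpha>) + 1)" for n
        using alpha by (intro powr_mono) auto
      then show "\<forall>\<^sub>F n in sequentially. real (Suc n) \<le> real (Suc n) powr (1 / (2 * \<alpha>) + 1)"
        by simp
    qed
    then have "\<forall>\<^sub>F n in sequentially. \<bar>x\<bar> powr (- 1 - 2 * \<alpha>) \<le> real (Suc n) powr (1 / (2 * \<alpha>) + 1)"
      by (simp add: filterlim_at_top)
    then have ev: "\<forall>\<^sub>F n in sequentially. kernel_profile \<alpha> (1 / real (Suc n)) x / (1 / real (Suc n)) = \<bar>x\<bar> powr (- 1 - 2 * \<alpha>)"
    proof eventually_elim
      case (elim n)
      have "(1 / real (Suc n)) powr (- 1 / (2 * \<alpha>)) = real (Suc n) powr (1 / (2 * \<alpha>))"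
        by (simp add: powr_divide powr_minus divide_simps del: of_nat_Suc)
      also have "\<dots> = real (Suc n) powr (1 / (2 * \<alpha>) + 1) / real (Suc n)"
        by (simp add: powr_add del: of_nat_Suc)
      finally have "(1 / real (Suc n)) powr (- 1 / (2 * \<alpha>)) = real (Suc n) powr (1 / (2 * \<alpha>) + 1) / real (Suc n)" .
      then have "min ((1 / real (Suc n)) powr (- 1 / (2 * \<alpha>))) (1 / real (Suc n) * \<bar>x\<bar> powr (- 1 - 2 * \<alpha>))
          = 1 / real (Suc n) * \<bar>x\<bar> powr (- 1 - 2 * \<alpha>)"
        using elim by (simp add: min_absorb2 divide_right_mono del: of_nat_Suc)
      then show ?case
        using that by (simp add: kernel_profile_def del: of_nat_Suc)
    qed
    have gl: "(\<lambda>n. exp (- (1 / real (Suc n) * x)\<^sup>2 / 2) - exp (- x\<^sup>2 / 2)) \<longlonglongrightarrow> exp (- (0 * x)\<^sup>2 / 2) - exp (- x\<^sup>2 / 2)"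
      using LIMSEQ_inverse_real_of_nat by (intro tendsto_intros) (auto simp: inverse_eq_divide)
    have "(\<lambda>n. c * (\<bar>x\<bar> powr (- 1 - 2 * \<alpha>)) * (exp (- (1 / real (Suc n) * x)\<^sup>2 / 2) - exp (- x\<^sup>2 / 2)))
       \<longlonglongrightarrow> c * (\<bar>x\<bar> powr (- 1 - 2 * \<alpha>)) * (exp (- (0 * x)\<^sup>2 / 2) - exp (- x\<^sup>2 / 2))"
      by (intro tendsto_mult tendsto_const gl)
    moreover have "\<forall>\<^sub>F n in sequentially. c * (\<bar>x\<bar> powr (- 1 - 2 * \<alpha>)) *
        (exp (- (1 / real (Suc n) * x)\<^sup>2 / 2) - exp (- x\<^sup>2 / 2)) = ?h n x"
      using ev by eventually_elim (simp only:)
    ultimately have "(\<lambda>n. ?h n x) \<longlonglongrightarrow> c * (\<bar>x\<bar> powr (- 1 - 2 * \<alpha>)) * (exp (- (0 * x)\<^sup>2 / 2) - exp (- x\<^sup>2 / 2))"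
      by (rule Lim_transform_eventually)
    then show "(\<lambda>n. ?h n x) \<longlonglongrightarrow> c * (\<bar>x\<bar> powr (- 1 - 2 * \<alpha>) * (1 - exp (- x\<^sup>2 / 2)))"
      by (simp add: mult.assoc del: of_nat_Suc)
  qed
  have "ennreal c * gauss_gap \<alpha> = (\<integral>\<^sup>+x. ennreal (c * (\<bar>x\<bar> powr (- 1 - 2 * \<alpha>) * (1 - exp (- x\<^sup>2 / 2)))) \<partial>lborel)"
    using \<open>0 < c\<close> by (simp add: gauss_gap_def nn_integral_levy_measure ennreal_mult' flip: nn_integral_cmult)
  also have "\<dots> = (\<integral>\<^sup>+x. liminf (\<lambda>n. ennreal (?h n x)) \<partial>lborel)"
  proof (rule nn_integral_cong_AE)
    have "AE x in lborel. x \<noteq> (0::real)" by (rule AE_lborel_singleton)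
    then show "AE x in lborel. ennreal (c * (\<bar>x\<bar> powr (- 1 - 2 * \<alpha>) * (1 - exp (- x\<^sup>2 / 2)))) = liminf (\<lambda>n. ennreal (?h n x))"
      by eventually_elim (rule lim_imp_Liminf[OF _ lim, symmetric], auto)
  qed
  also have "\<dots> \<le> liminf (\<lambda>n. \<integral>\<^sup>+x. ennreal (?h n x) \<partial>lborel)"
    unfolding kernel_profile_def by (rule nn_integral_liminf) measurable
  also have "\<dots> \<le> gauss_moment \<alpha>"
    by (intro Liminf_le always_eventually allI kernel_profile_bound) simp_all
  finally show ?thesis .
qed

end

section \<open>The reflection inequality on the line\<close>

definition odd_ext :: "(real \<Rightarrow> real) \<Rightarrow> real \<Rightarrow> real" where
  "odd_ext w s = w (max s 0) - w (max (- s) 0)"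

definition second_gap :: "(real \<Rightarrow> real) \<Rightarrow> real \<Rightarrow> real \<Rightarrow> real" where
  "second_gap w \<xi> s = 2 * w \<xi> - odd_ext w (\<xi> + 2 * s) - odd_ext w (\<xi> - 2 * s)"

lemma odd_ext_minus: "odd_ext w (- s) = - odd_ext w s"
  by (simp add: odd_ext_def)

lemma second_gap_minus: "second_gap w \<xi> (- s) = second_gap w \<xi> s"
  by (simp add: second_gap_def)

context
  fixes w :: "real \<Rightarrow> real"
  assumes moc: "modulus_of_continuity w"
begin

private lemma nonneg: "0 \<le> s \<Longrightarrow> 0 \<le> w s"
  and zero: "w 0 = 0"
  and cont: "continuous_on {0..} w"
  and mono: "0 \<le> s \<Longrightarrow> s \<le> t \<Longrightarrow> w s \<le> w t"
  and conc: "concave_on {0..} w"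
  using moc by (auto simp: modulus_of_continuity_def mono_on_def)

private lemma concD:
  "0 \<le> a \<Longrightarrow> 0 \<le> b \<Longrightarrow> 0 \<le> u \<Longrightarrow> 0 \<le> v \<Longrightarrow> u + v = 1 \<Longrightarrow> u * w a + v * w b \<le> w (u * a + v * b)"
  using conc unfolding concave_on_iff by (metis atLeast_iff real_scaleR_def)

lemma odd_ext_nonneg_arg: "0 \<le> s \<Longrightarrow> odd_ext w s = w s"
  by (simp add: odd_ext_def zero)

lemma continuous_on_odd_ext: "continuous_on UNIV (odd_ext w)"
  unfolding odd_ext_def
  by (intro continuous_intros continuous_on_compose2[OF cont]) auto

lemma borel_measurable_odd_ext [measurable]: "odd_ext w \<in> borel_measurable borel"
  by (rule borel_measurable_continuous_onI[OF continuous_on_odd_ext])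

lemma borel_measurable_second_gap [measurable]: "second_gap w \<xi> \<in> borel_measurable borel"
  unfolding second_gap_def by measurable

private lemma chord: "0 \<le> a \<Longrightarrow> 0 < c \<Longrightarrow> a \<le> c \<Longrightarrow> a / c * w c \<le> w a"
  using concD[of c 0 "a / c" "1 - a / c"] by (simp add: zero)

private lemma subadd:
  assumes "0 \<le> a" "0 \<le> b"
  shows "w (a + b) \<le> w a + w b"
proof (cases "a + b = 0")
  case True
  then show ?thesis using nonneg[OF assms(1)] nonneg[OF assms(2)] by (simp add: zero)
next
  case False
  then have *: "a / (a + b) * w (a + b) \<le> w a" "b / (a + b) * w (a + b) \<le> w b"
    using assms by (intro chord; simp)+
  have "w (a + b) = (a / (a + b) + b / (a + b)) * w (a + b)"
    using False by (simp flip: add_divide_distrib)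
  also have "\<dots> = a / (a + b) * w (a + b) + b / (a + b) * w (a + b)"
    by (rule distrib_right)
  finally show ?thesis using * by linarith
qed

lemma odd_ext_growth: "\<bar>odd_ext w s\<bar> \<le> w 1 + w 1 * \<bar>s\<bar>"
proof -
  have *: "\<bar>w t\<bar> \<le> w 1 + w 1 * t" if "0 \<le> t" for t
  proof (cases "t \<le> 1")
    case True
    then show ?thesis using that mono[of t 1] nonneg[of t] nonneg[of 1] by (simp add: add_increasing2)
  next
    case False
    then show ?thesis
      using chord[of 1 t] nonneg[of t] nonneg[of 1] by (simp add: field_simps)
  qed
  show ?thesis
    using *[of s] *[of "- s"] by (cases "0 \<le> s") (auto simp: odd_ext_def zero)
qed

lemma second_gap_nonneg:
  assumes "0 < \<xi>"
  shows "0 \<le> second_gap w \<xi> s"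
proof -
  have *: "0 \<le> second_gap w \<xi> s" if "0 \<le> s" for s
  proof (cases "2 * s \<le> \<xi>")
    case True
    then show ?thesis
      using concD[of "\<xi> + 2 * s" "\<xi> - 2 * s" "1/2" "1/2"] that assms
      by (simp add: second_gap_def odd_ext_nonneg_arg field_simps)
  next
    case False
    have "w (\<xi> + 2 * s) \<le> w (2 * s - \<xi>) + w \<xi> + w \<xi>"
      using subadd[of "2 * s - \<xi>" "2 * \<xi>"] subadd[of \<xi> \<xi>] assms False by (simp add: algebra_simps)
    then show ?thesis
      using False that assms odd_ext_minus[of w "\<xi> - 2 * s"]
      by (simp add: second_gap_def odd_ext_nonneg_arg)
  qed
  show ?thesis
    using *[of s] *[of "- s"] second_gap_minus[of w \<xi> s] by (cases "0 \<le> s") auto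
qed

end

lemma gauss_integrable_growth:
  fixes F :: "real \<Rightarrow> real"
  assumes [measurable]: "F \<in> borel_measurable borel" and F: "\<And>s. \<bar>F s\<bar> \<le> A + B * \<bar>s\<bar>"
  shows "integrable std_normal_distribution (\<lambda>n. F (b + \<sigma> * n))"
proof (rule Bochner_Integration.integrable_bound)
  interpret N: prob_space std_normal_distribution by (rule prob_space_normal_density) simp
  show "integrable std_normal_distribution (\<lambda>n. \<bar>A\<bar> + \<bar>B\<bar> * (\<bar>b\<bar> + \<bar>\<sigma>\<bar> * \<bar>n\<bar>))"
    using integrable_std_normal_distribution_moment[of 1] by (auto intro!: integrable_mult_right)
  show "AE n in std_normal_distribution. norm (F (b + \<sigma> * n)) \<le> norm (\<bar>A\<bar> + \<bar>B\<bar> * (\<bar>b\<bar> + \<bar>\<sigma>\<bar> * \<bar>n\<bar>))"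
  proof (rule AE_I2)
    fix n
    have "\<bar>F (b + \<sigma> * n)\<bar> \<le> A + B * \<bar>b + \<sigma> * n\<bar>" by (rule F)
    also have "\<dots> \<le> \<bar>A\<bar> + \<bar>B\<bar> * \<bar>b + \<sigma> * n\<bar>"
      by (intro add_mono mult_right_mono) auto
    also have "\<dots> \<le> \<bar>A\<bar> + \<bar>B\<bar> * (\<bar>b\<bar> + \<bar>\<sigma>\<bar> * \<bar>n\<bar>)"
      by (intro add_mono mult_left_mono order.refl order.trans[OF abs_triangle_ineq]) (auto simp: abs_mult)
    finally show "norm (F (b + \<sigma> * n)) \<le> norm (\<bar>A\<bar> + \<bar>B\<bar> * (\<bar>b\<bar> + \<bar>\<sigma>\<bar> * \<bar>n\<bar>))"
      by simp
  qed
qed measurable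

lemma gauss_integral_shift:
  fixes F :: "real \<Rightarrow> real"
  assumes [measurable]: "F \<in> borel_measurable borel" and "\<sigma> \<noteq> 0"
  shows "(LINT n|std_normal_distribution. F (b + \<sigma> * n)) =
      (LINT s|lborel. std_normal_density ((s - b) / \<sigma>) / \<bar>\<sigma>\<bar> * F s)"
    and "integrable std_normal_distribution (\<lambda>n. F (b + \<sigma> * n)) \<Longrightarrow>
      integrable lborel (\<lambda>s. std_normal_density ((s - b) / \<sigma>) / \<bar>\<sigma>\<bar> * F s)"
proof -
  let ?g = "\<lambda>s. std_normal_density ((s - b) / \<sigma>) / \<bar>\<sigma>\<bar> * F s"
  show "(LINT n|std_normal_distribution. F (b + \<sigma> * n)) = (LINT s|lborel. ?g s)"
    using \<open>\<sigma> \<noteq> 0\<close>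
    by (subst lborel_integral_real_affine[of \<sigma> ?g b]) (auto simp: integral_density)
  assume "integrable std_normal_distribution (\<lambda>n. F (b + \<sigma> * n))"
  then have "integrable lborel (\<lambda>n. std_normal_density n * F (b + \<sigma> * n) / \<bar>\<sigma>\<bar>)"
    by (intro integrable_divide) (simp add: integrable_density)
  then have "integrable lborel (\<lambda>n. ?g (b + \<sigma> * n))"
    using \<open>\<sigma> \<noteq> 0\<close> by simp
  then show "integrable lborel ?g"
    using lborel_integrable_real_affine_iff[of \<sigma> ?g b] \<open>\<sigma> \<noteq> 0\<close> by blast
qed

lemma gauss_reflection:
  fixes \<phi> w :: "real \<Rightarrow> real"
  assumes moc: "modulus_of_continuity w" and "0 < \<xi>" and "\<sigma> \<noteq> 0"
    and cont: "continuous_on UNIV \<phi>" and bdd: "\<And>s. \<bar>\<phi> s\<bar> \<le> B"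
    and mod: "\<And>s t. \<bar>\<phi> s - \<phi> t\<bar> \<le> w \<bar>s - t\<bar>"
  shows "integrable std_normal_distribution (\<lambda>n. second_gap w \<xi> (\<sigma> * n))" (is ?int)
    and "(LINT n|std_normal_distribution. \<phi> (\<xi> / 2 + \<sigma> * n)) - (LINT n|std_normal_distribution. \<phi> (- \<xi> / 2 + \<sigma> * n))
      \<le> w \<xi> - (LINT n|std_normal_distribution. second_gap w \<xi> (\<sigma> * n)) / 2" (is ?le)
proof -
  interpret N: prob_space std_normal_distribution by (rule prob_space_normal_density) simp
  note [measurable] = borel_measurable_odd_ext[OF moc] borel_measurable_second_gap[OF moc]
    borel_measurable_continuous_onI[OF cont]
  let ?\<Omega> = "\<lambda>s. odd_ext w (2 * s)"
  let ?g = "\<lambda>b s. std_normal_density ((s - b) / \<sigma>) / \<bar>\<sigma>\<bar>"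
  define k where "k s = ?g (\<xi> / 2) s - ?g (- \<xi> / 2) s" for s
  have phi: "integrable std_normal_distribution (\<lambda>n. \<phi> (b + \<sigma> * n))" for b
    using bdd by (intro gauss_integrable_growth[where A = B and B = 0]) auto
  have Om: "integrable std_normal_distribution (\<lambda>n. ?\<Omega> (b + \<sigma> * n))" for b
    using odd_ext_growth[OF moc, of "2 * s" for s]
    by (intro gauss_integrable_growth[where A = "w 1" and B = "2 * w 1"]) (auto simp: abs_mult mult_ac)
  have *: "(LINT n|std_normal_distribution. F (\<xi> / 2 + \<sigma> * n)) - (LINT n|std_normal_distribution. F (- \<xi> / 2 + \<sigma> * n))
      = (LINT s|lborel. k s * F s)" "integrable lborel (\<lambda>s. k s * F s)"
    if [measurable]: "F \<in> borel_measurable borel" and F: "\<And>b. integrable std_normal_distribution (\<lambda>n. F (b + \<sigma> * n))" for F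
    unfolding gauss_integral_shift(1)[OF that(1) \<open>\<sigma> \<noteq> 0\<close>] k_def left_diff_distrib
    by (intro Bochner_Integration.integral_diff[symmetric] Bochner_Integration.integrable_diff
        gauss_integral_shift(2)[OF that(1) \<open>\<sigma> \<noteq> 0\<close> F])+
  have k_odd: "k (- s) = - k s" for s
  proof -
    have "std_normal_density ((- s - \<xi> / 2) / \<sigma>) = std_normal_density ((s + \<xi> / 2) / \<sigma>)"
      "std_normal_density ((- s + \<xi> / 2) / \<sigma>) = std_normal_density ((s - \<xi> / 2) / \<sigma>)"
      by (auto simp: std_normal_density_def power_divide power2_commute power2_eq_square algebra_simps)
    then show ?thesis by (simp add: k_def)
  qed
  have k_pos: "0 \<le> k s" if "0 \<le> s" for s
  proof -
    have "(s - \<xi> / 2)\<^sup>2 \<le> (s + \<xi> / 2)\<^sup>2"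
      using that \<open>0 < \<xi>\<close> by (simp add: power2_eq_square algebra_simps)
    then have "((s - \<xi> / 2) / \<sigma>)\<^sup>2 \<le> ((s + \<xi> / 2) / \<sigma>)\<^sup>2"
      by (simp add: power_divide divide_right_mono)
    then show ?thesis
      by (simp add: k_def std_normal_density_def divide_right_mono)
  qed
  let ?\<psi> = "\<lambda>s. \<phi> s - \<phi> (- s)"
  have phi_m: "integrable std_normal_distribution (\<lambda>n. \<phi> (- (b + \<sigma> * n)))" for b
    using bdd by (intro gauss_integrable_growth[where A = B and B = 0 and F = "\<lambda>s. \<phi> (- s)"]) auto
  note kphi = *[of \<phi>, OF _ phi] and kOm = *[of ?\<Omega>, OF _ Om] and kphi_m = *[of "\<lambda>s. \<phi> (- s)", OF _ phi_m]
  have "(LINT s|lborel. k s * \<phi> (- s)) = (LINT s|lborel. k (- s) * \<phi> (- (- s)))"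
    using lborel_integral_real_affine[of "-1" "\<lambda>s. k s * \<phi> (- s)" 0] by simp
  then have "(LINT s|lborel. k s * \<phi> (- s)) = - (LINT s|lborel. k s * \<phi> s)"
    by (simp add: k_odd)
  then have "2 * (LINT s|lborel. k s * \<phi> s) = (LINT s|lborel. k s * \<phi> s) - (LINT s|lborel. k s * \<phi> (- s))"
    by simp
  also have "\<dots> = (LINT s|lborel. k s * \<phi> s - k s * \<phi> (- s))"
    using kphi(2) kphi_m(2) by simp
  also have "\<dots> \<le> (LINT s|lborel. k s * ?\<Omega> s)"
  proof (rule integral_mono)
    show "integrable lborel (\<lambda>s. k s * \<phi> s - k s * \<phi> (- s))"
      using kphi(2) kphi_m(2) by simp
    show "integrable lborel (\<lambda>s. k s * ?\<Omega> s)" using kOm(2) by simp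
    fix s
    have pos: "?\<psi> t \<le> ?\<Omega> t" if "0 \<le> t" for t
      using mod[of t "- t"] that by (simp add: odd_ext_nonneg_arg[OF moc] abs_le_iff)
    show "k s * \<phi> s - k s * \<phi> (- s) \<le> k s * ?\<Omega> s"
    proof (cases "0 \<le> s")
      case True
      then show ?thesis using mult_left_mono[OF pos k_pos] by (simp add: right_diff_distrib)
    next
      case False
      then have "k (- s) * ?\<psi> (- s) \<le> k (- s) * ?\<Omega> (- s)"
        by (intro mult_left_mono pos k_pos) auto
      then show ?thesis
        using odd_ext_minus[of w "2 * s"] by (simp add: k_odd algebra_simps)
    qed
  qed
  also have "\<dots> = (LINT n|std_normal_distribution. ?\<Omega> (\<xi> / 2 + \<sigma> * n)) - (LINT n|std_normal_distribution. ?\<Omega> (- \<xi> / 2 + \<sigma> * n))"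
    using kOm(1) by simp
  also have "\<dots> = (LINT n|std_normal_distribution. ?\<Omega> (\<xi> / 2 + \<sigma> * n) - ?\<Omega> (- \<xi> / 2 + \<sigma> * n))"
    by (intro Bochner_Integration.integral_diff[symmetric] Om)
  also have "\<dots> = (LINT n|std_normal_distribution. 2 * w \<xi> - second_gap w \<xi> (\<sigma> * n))"
    using odd_ext_minus[of w "\<xi> - 2 * \<sigma> * n" for n]
    by (intro Bochner_Integration.integral_cong) (auto simp: second_gap_def algebra_simps)
  finally have le: "2 * (LINT s|lborel. k s * \<phi> s) \<le> (LINT n|std_normal_distribution. 2 * w \<xi> - second_gap w \<xi> (\<sigma> * n))" .
  have "integrable std_normal_distribution (\<lambda>n. 2 * w \<xi> - (?\<Omega> (\<xi> / 2 + \<sigma> * n) - ?\<Omega> (- \<xi> / 2 + \<sigma> * n)))"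
    by (intro Bochner_Integration.integrable_diff Om) auto
  also have "(\<lambda>n. 2 * w \<xi> - (?\<Omega> (\<xi> / 2 + \<sigma> * n) - ?\<Omega> (- \<xi> / 2 + \<sigma> * n))) = (\<lambda>n. second_gap w \<xi> (\<sigma> * n))"
    using odd_ext_minus[of w "\<xi> - 2 * \<sigma> * n" for n] by (auto simp: second_gap_def algebra_simps)
  finally show ?int .
  then have "(LINT n|std_normal_distribution. 2 * w \<xi> - second_gap w \<xi> (\<sigma> * n)) =
      2 * w \<xi> - (LINT n|std_normal_distribution. second_gap w \<xi> (\<sigma> * n))"
    by (simp add: N.prob_space[simplified])
  then show ?le
    using le kphi(1) by simp
qed

section \<open>Gaussian averages of trigonometric series\<close>

abbreviation std_normal_family :: "('d::finite \<Rightarrow> real) measure" where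
  "std_normal_family \<equiv> Pi\<^sub>M UNIV (\<lambda>_. std_normal_distribution)"

lemma prob_space_std_normal_family: "prob_space (std_normal_family :: ('d::finite \<Rightarrow> real) measure)"
  by (intro prob_space_PiM prob_space_normal_density) simp

lemma cis_sum: "cis (sum f A) = (\<Prod>i\<in>A. cis (f i))"
  by (induction A rule: infinite_finite_induct) (auto simp flip: cis_mult)

lemma borel_measurable_cis [measurable]: "cis \<in> borel_measurable borel"
  by (intro borel_measurable_continuous_onI continuous_intros)

lemma gauss_cis_vec:
  fixes v :: "real ^ 'd"
  shows "(CLINT z|std_normal_family. cis (v \<bullet> (\<chi> i. z i))) = complex_of_real (exp (- (norm v)\<^sup>2 / 2))"
proof -
  interpret N: prob_space std_normal_distribution by (rule prob_space_normal_density) simp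
  interpret P: product_sigma_finite "\<lambda>_::'d. std_normal_distribution" ..
  have "(CLINT z|std_normal_family. cis (v \<bullet> (\<chi> i. z i))) =
      (CLINT z|std_normal_family. (\<Prod>i\<in>UNIV. cis (v $ i * z i)))"
    by (simp add: inner_vec_def cis_sum)
  also have "\<dots> = (\<Prod>i\<in>UNIV. CLINT n|std_normal_distribution. cis (v $ i * n))"
    by (rule P.product_integral_prod) (auto intro!: N.integrable_const_bound[where B = 1])
  also have "\<dots> = complex_of_real (exp (\<Sum>i\<in>UNIV. - (v $ i)\<^sup>2 / 2))"
    by (simp add: gauss_cis exp_sum)
  also have "(\<Sum>i\<in>UNIV. - (v $ i)\<^sup>2 / 2) = - (norm v)\<^sup>2 / 2"
    unfolding power2_norm_eq_inner inner_vec_def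
    by (simp add: sum_negf sum_divide_distrib power2_eq_square)
  finally show ?thesis .
qed

text \<open>With \<open>n\<close> and the coordinates of \<open>z\<close> independent standard normals, the Gaussian point is \<open>x\<close> plus
  \<open>\<sigma>\<close> times a standard Gaussian vector whose component along the unit vector \<open>e\<close> is \<open>n\<close>. Only its
  characteristic function is needed, so no rotation of coordinates is involved.\<close>

definition gauss_point :: "real ^ 'd \<Rightarrow> real \<Rightarrow> real ^ 'd \<Rightarrow> ('d \<Rightarrow> real) \<Rightarrow> real \<Rightarrow> real ^ 'd" where
  "gauss_point e \<sigma> x z n =
     x + \<sigma> *\<^sub>R ((\<chi> i. z i) - (e \<bullet> (\<chi> i. z i)) *\<^sub>R e) + (\<sigma> * n) *\<^sub>R e"

lemma borel_measurable_vec_lambda [measurable]: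
  "(\<lambda>z. \<chi> i. z i) \<in> measurable (std_normal_family :: ('d::finite \<Rightarrow> real) measure) (borel :: (real ^ 'd) measure)"
  by (subst borel_measurable_euclidean_space) (auto simp: Basis_vec_def inner_axis)

lemma borel_measurable_gauss_point:
  "(\<lambda>(z, n). k \<bullet> gauss_point e \<sigma> x z n) \<in> borel_measurable (std_normal_family \<Otimes>\<^sub>M std_normal_distribution)"
  unfolding gauss_point_def by measurable

lemma borel_measurable_gauss_point' [measurable]:
  "(\<lambda>n. k \<bullet> gauss_point e \<sigma> x z n) \<in> borel_measurable borel"
  unfolding gauss_point_def by measurable

lemma gauss_cos_point:
  fixes e k x :: "real ^ 'd"
  assumes "norm e = 1"
  shows "(LINT z|std_normal_family. LINT n|std_normal_distribution. cos (k \<bullet> gauss_point e \<sigma> x z n + \<phi>))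
    = exp (- (\<sigma> * norm k)\<^sup>2 / 2) * cos (k \<bullet> x + \<phi>)"
proof -
  interpret N: prob_space std_normal_distribution by (rule prob_space_normal_density) simp
  interpret Z: prob_space "std_normal_family :: ('d \<Rightarrow> real) measure" by (rule prob_space_std_normal_family)
  define v where "v = k - (k \<bullet> e) *\<^sub>R e"
  have ee: "e \<bullet> e = 1" using assms by (simp add: dot_square_norm)
  have v: "(norm v)\<^sup>2 = (norm k)\<^sup>2 - (k \<bullet> e)\<^sup>2"
    unfolding v_def power2_norm_eq_inner
    by (simp add: inner_diff ee inner_commute[of e k] power2_eq_square)
  have arg: "k \<bullet> gauss_point e \<sigma> x z n + \<phi> = (k \<bullet> x + \<phi>) + (\<sigma> *\<^sub>R v) \<bullet> (\<chi> i. z i) + (\<sigma> * (k \<bullet> e)) * n" for z n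
    by (simp add: gauss_point_def v_def inner_add inner_diff algebra_simps inner_commute)
  have inner: "(LINT n|std_normal_distribution. cos (k \<bullet> gauss_point e \<sigma> x z n + \<phi>)) =
      Re (cis ((k \<bullet> x + \<phi>) + (\<sigma> *\<^sub>R v) \<bullet> (\<chi> i. z i)) * complex_of_real (exp (- (\<sigma> * (k \<bullet> e))\<^sup>2 / 2)))" for z
  proof -
    have "integrable std_normal_distribution (\<lambda>n. cis (k \<bullet> gauss_point e \<sigma> x z n + \<phi>))"
      by (rule N.integrable_const_bound[where B = 1]) auto
    from integral_Re[OF this]
    have "(LINT n|std_normal_distribution. cos (k \<bullet> gauss_point e \<sigma> x z n + \<phi>)) =
        Re (CLINT n|std_normal_distribution. cis (k \<bullet> gauss_point e \<sigma> x z n + \<phi>))"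
      by simp
    also have "(CLINT n|std_normal_distribution. cis (k \<bullet> gauss_point e \<sigma> x z n + \<phi>)) =
        cis ((k \<bullet> x + \<phi>) + (\<sigma> *\<^sub>R v) \<bullet> (\<chi> i. z i)) * (CLINT n|std_normal_distribution. cis ((\<sigma> * (k \<bullet> e)) * n))"
      unfolding arg cis_mult[symmetric] by (rule integral_mult_right_zero)
    finally show ?thesis unfolding gauss_cis .
  qed
  have "integrable std_normal_family (\<lambda>z::'d \<Rightarrow> real. cis ((k \<bullet> x + \<phi>) + (\<sigma> *\<^sub>R v) \<bullet> (\<chi> i. z i)) * complex_of_real (exp (- (\<sigma> * (k \<bullet> e))\<^sup>2 / 2)))"
    by (rule Z.integrable_const_bound[where B = 1]) (auto simp: norm_mult)
  from integral_Re[OF this]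
  have "(LINT z|std_normal_family. LINT n|std_normal_distribution. cos (k \<bullet> gauss_point e \<sigma> x z n + \<phi>)) =
     Re (CLINT z|std_normal_family. cis (k \<bullet> x + \<phi>) * complex_of_real (exp (- (\<sigma> * (k \<bullet> e))\<^sup>2 / 2)) * cis ((\<sigma> *\<^sub>R v) \<bullet> (\<chi> i. z i)))"
    unfolding inner by (simp add: cis_mult[symmetric] mult_ac)
  also have "\<dots> = Re (cis (k \<bullet> x + \<phi>) * complex_of_real (exp (- (\<sigma> * (k \<bullet> e))\<^sup>2 / 2)) * complex_of_real (exp (- (norm (\<sigma> *\<^sub>R v))\<^sup>2 / 2)))"
    by (subst integral_mult_right_zero) (simp only: gauss_cis_vec)
  also have "\<dots> = cos (k \<bullet> x + \<phi>) * (exp (- (\<sigma> * (k \<bullet> e))\<^sup>2 / 2) * exp (- (norm (\<sigma> *\<^sub>R v))\<^sup>2 / 2))"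
    by (simp flip: of_real_mult)
  also have "exp (- (\<sigma> * (k \<bullet> e))\<^sup>2 / 2) * exp (- (norm (\<sigma> *\<^sub>R v))\<^sup>2 / 2) = exp (- (\<sigma> * norm k)\<^sup>2 / 2)"
    unfolding exp_add[symmetric] by (simp add: power_mult_distrib v algebra_simps add_divide_distrib[symmetric])
  finally show ?thesis by simp
qed

context
  fixes r \<phi> :: "nat \<Rightarrow> real" and \<kappa> :: "nat \<Rightarrow> real ^ 'd" and f :: "real ^ 'd \<Rightarrow> real"
  assumes r_nonneg: "\<And>j. 0 \<le> r j" and r_summable: "summable r"
    and f_series: "\<And>x. f x = (\<Sum>j. r j * cos (\<kappa> j \<bullet> x + \<phi> j))"
begin

private lemma summable_dominated:
  assumes "\<And>j. \<bar>a j\<bar> \<le> 1"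
  shows "summable (\<lambda>j. r j * a j)" "summable (\<lambda>j. \<bar>r j * a j\<bar>)"
proof -
  show *: "summable (\<lambda>j. \<bar>r j * a j\<bar>)"
    by (rule summable_comparison_test'[OF r_summable, of 0])
       (use assms r_nonneg in \<open>auto simp: abs_mult intro!: mult_left_le\<close>)
  then show "summable (\<lambda>j. r j * a j)" by (rule summable_rabs_cancel)
qed

private lemma prob_integral_suminf:
  assumes "prob_space M"
    and meas: "\<And>j. a j \<in> borel_measurable M" and bdd: "\<And>j z. \<bar>a j z\<bar> \<le> 1"
  shows "(LINT z|M. (\<Sum>j. r j * a j z)) = (\<Sum>j. r j * (LINT z|M. a j z))"
    and "integrable M (\<lambda>z. \<Sum>j. r j * a j z)"
proof -
  interpret M: prob_space M by fact
  note meas[measurable]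
  have int: "integrable M (a j)" for j
    using bdd by (intro M.integrable_const_bound[where B = 1]) auto
  have le: "\<bar>LINT z|M. \<bar>a j z\<bar>\<bar> \<le> 1" for j
    using M.integral_le_const[of "\<lambda>z. \<bar>a j z\<bar>" 1] int bdd by (simp add: integral_nonneg_AE)
  have "summable (\<lambda>j. LINT z|M. norm (r j * a j z))"
    using summable_dominated(1)[OF le] r_nonneg by (simp add: abs_mult)
  moreover have "AE z in M. summable (\<lambda>j. norm (r j * a j z))"
    using summable_dominated(2)[OF bdd] by simp
  ultimately show "(LINT z|M. (\<Sum>j. r j * a j z)) = (\<Sum>j. r j * (LINT z|M. a j z))"
    and "integrable M (\<lambda>z. \<Sum>j. r j * a j z)"
    using int by (simp_all add: integral_suminf integrable_suminf)
qed

definition heat_series :: "real \<Rightarrow> real ^ 'd \<Rightarrow> real" where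
  "heat_series \<sigma> x = (\<Sum>j. r j * (exp (- (\<sigma> * norm (\<kappa> j))\<^sup>2 / 2) * cos (\<kappa> j \<bullet> x + \<phi> j)))"

lemma heat_series_gauss:
  fixes e :: "real ^ 'd"
  assumes "norm e = 1"
  shows "heat_series \<sigma> x = (LINT z|std_normal_family. LINT n|std_normal_distribution. f (gauss_point e \<sigma> x z n))" (is ?eq)
    and "integrable std_normal_family (\<lambda>z. LINT n|std_normal_distribution. f (gauss_point e \<sigma> x z n))" (is ?int)
proof -
  interpret N: prob_space std_normal_distribution by (rule prob_space_normal_density) simp
  interpret Z: prob_space "std_normal_family :: ('d \<Rightarrow> real) measure" by (rule prob_space_std_normal_family)
  let ?q = "\<lambda>j z. LINT n|std_normal_distribution. cos (\<kappa> j \<bullet> gauss_point e \<sigma> x z n + \<phi> j)"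
  have q: "(LINT n|std_normal_distribution. f (gauss_point e \<sigma> x z n)) = (\<Sum>j. r j * ?q j z)" for z
    unfolding f_series by (rule prob_integral_suminf) (auto intro: N.prob_space_axioms)
  have q1: "\<bar>?q j z\<bar> \<le> 1" for j z
  proof -
    have "integrable std_normal_distribution (\<lambda>n. cos (\<kappa> j \<bullet> gauss_point e \<sigma> x z n + \<phi> j))"
      by (rule N.integrable_const_bound[where B = 1]) auto
    then show ?thesis
      using N.integral_le_const[of "\<lambda>n. cos (\<kappa> j \<bullet> gauss_point e \<sigma> x z n + \<phi> j)" 1]
        N.integral_ge_const[of "\<lambda>n. cos (\<kappa> j \<bullet> gauss_point e \<sigma> x z n + \<phi> j)" "-1"]
      by (simp add: abs_le_iff)
  qed
  have qm: "?q j \<in> borel_measurable std_normal_family" for j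
  proof (rule N.borel_measurable_lebesgue_integral)
    note borel_measurable_gauss_point[measurable]
    have "(\<lambda>p. cos ((\<lambda>(z, n). \<kappa> j \<bullet> gauss_point e \<sigma> x z n) p + \<phi> j)) \<in> borel_measurable (std_normal_family \<Otimes>\<^sub>M std_normal_distribution)"
      by measurable
    then show "(\<lambda>(z, n). cos (\<kappa> j \<bullet> gauss_point e \<sigma> x z n + \<phi> j)) \<in> borel_measurable (std_normal_family \<Otimes>\<^sub>M std_normal_distribution)"
      by (simp add: case_prod_beta)
  qed
  show ?eq
    unfolding q prob_integral_suminf(1)[OF Z.prob_space_axioms qm q1] gauss_cos_point[OF assms] heat_series_def ..
  show ?int
    unfolding q by (rule prob_integral_suminf(2)[OF Z.prob_space_axioms qm q1])
qed

lemma heat_series_diff_le: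
  assumes moc: "modulus_of_continuity w" and "x \<noteq> y" and "\<sigma> \<noteq> 0"
    and cont: "continuous_on UNIV f"
    and mod: "\<And>a b. \<bar>f a - f b\<bar> \<le> w (norm (a - b))"
  shows "heat_series \<sigma> x - heat_series \<sigma> y \<le>
    w (norm (x - y)) - (LINT n|std_normal_distribution. second_gap w (norm (x - y)) (\<sigma> * n)) / 2"
proof -
  interpret Z: prob_space "std_normal_family :: ('d \<Rightarrow> real) measure" by (rule prob_space_std_normal_family)
  define \<xi> where "\<xi> = norm (x - y)"
  define e where "e = (1 / \<xi>) *\<^sub>R (x - y)"
  have "0 < \<xi>" using \<open>x \<noteq> y\<close> by (simp add: \<xi>_def)
  have e: "norm e = 1" using \<open>x \<noteq> y\<close> by (simp add: e_def \<xi>_def)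
  let ?I = "\<lambda>x z. LINT n|std_normal_distribution. f (gauss_point e \<sigma> x z n)"
  let ?m = "\<lambda>z. (1/2) *\<^sub>R (x + y) + \<sigma> *\<^sub>R ((\<chi> i. z i) - (e \<bullet> (\<chi> i. z i)) *\<^sub>R e)"
  have "heat_series \<sigma> x - heat_series \<sigma> y = (LINT z|std_normal_family. ?I x z - ?I y z)"
    unfolding heat_series_gauss(1)[OF e]
    by (rule Bochner_Integration.integral_diff[symmetric]) (rule heat_series_gauss(2)[OF e])+
  also have "\<dots> \<le> w \<xi> - (LINT n|std_normal_distribution. second_gap w \<xi> (\<sigma> * n)) / 2"
  proof (rule Z.integral_le_const)
    show "integrable std_normal_family (\<lambda>z. ?I x z - ?I y z)"
      by (intro Bochner_Integration.integrable_diff heat_series_gauss(2)[OF e])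
    show "AE z in std_normal_family. ?I x z - ?I y z \<le> w \<xi> - (LINT n|std_normal_distribution. second_gap w \<xi> (\<sigma> * n)) / 2"
    proof (rule AE_I2)
      fix z
      have point: "gauss_point e \<sigma> u z n = ?m z + (t + \<sigma> * n) *\<^sub>R e" if "u = (1/2) *\<^sub>R (x + y) + t *\<^sub>R e" for u t n
        unfolding that gauss_point_def by (simp add: algebra_simps)
      have half: "(\<xi> / 2) *\<^sub>R e = (1/2) *\<^sub>R (x - y)" "(- \<xi> / 2) *\<^sub>R e = (1/2) *\<^sub>R (y - x)"
        using \<open>0 < \<xi>\<close> by (simp_all add: e_def flip: scaleR_minus_right)
      have x: "gauss_point e \<sigma> x z n = ?m z + (\<xi> / 2 + \<sigma> * n) *\<^sub>R e" for n
        by (rule point) (simp add: half flip: scaleR_add_right)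
      have y: "gauss_point e \<sigma> y z n = ?m z + (- \<xi> / 2 + \<sigma> * n) *\<^sub>R e" for n
        by (rule point) (simp only: half scaleR_add_right[symmetric], simp)
      show "?I x z - ?I y z \<le> w \<xi> - (LINT n|std_normal_distribution. second_gap w \<xi> (\<sigma> * n)) / 2"
        unfolding x y
      proof (rule gauss_reflection(2)[OF moc \<open>0 < \<xi>\<close> \<open>\<sigma> \<noteq> 0\<close>, where \<phi> = "\<lambda>s. f (?m z + s *\<^sub>R e)"])
        show "continuous_on UNIV (\<lambda>s. f (?m z + s *\<^sub>R e))"
          by (intro continuous_on_compose2[OF cont] continuous_intros) auto
        show "\<bar>f (?m z + s *\<^sub>R e)\<bar> \<le> (\<Sum>j. r j)" for s
        proof -
          have "\<bar>f (?m z + s *\<^sub>R e)\<bar> \<le> (\<Sum>j. \<bar>r j * cos (\<kappa> j \<bullet> (?m z + s *\<^sub>R e) + \<phi> j)\<bar>)"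
            unfolding f_series by (intro summable_rabs summable_dominated) simp
          also have "\<dots> \<le> (\<Sum>j. r j)"
            by (intro suminf_le r_summable summable_dominated)
               (auto simp: abs_mult r_nonneg intro!: mult_left_le)
          finally show ?thesis .
        qed
        show "\<bar>f (?m z + s *\<^sub>R e) - f (?m z + t *\<^sub>R e)\<bar> \<le> w \<bar>s - t\<bar>" for s t
          using mod[of "?m z + s *\<^sub>R e" "?m z + t *\<^sub>R e"] e by (simp flip: scaleR_diff_left)
      qed
    qed
  qed
  finally show ?thesis by (simp add: \<xi>_def)
qed

lemma frac_laplacian_series_lower:
  fixes \<alpha> :: real
  defines "\<Lambda> \<equiv> \<lambda>x. \<Sum>j. r j * norm (\<kappa> j) powr (2 * \<alpha>) * cos (\<kappa> j \<bullet> x + \<phi> j)"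
  assumes moc: "modulus_of_continuity w" and "x \<noteq> y"
    and cont: "continuous_on UNIV f"
    and mod: "\<And>a b. \<bar>f a - f b\<bar> \<le> w (norm (a - b))"
    and touch: "f x - f y = w (norm (x - y))"
    and gap: "gauss_gap \<alpha> < \<infinity>"
    and smooth: "summable (\<lambda>j. r j * norm (\<kappa> j) powr (2 * \<alpha>))"
  shows "0 \<le> \<Lambda> x - \<Lambda> y" (is ?pos)
    and "gauss_moment \<alpha> * (\<integral>\<^sup>+s. ennreal (second_gap w (norm (x - y)) s / 2) \<partial>levy_measure \<alpha>)
      \<le> gauss_gap \<alpha> * ennreal (\<Lambda> x - \<Lambda> y)" (is ?le)
proof -
  define \<xi> where "\<xi> = norm (x - y)"
  have "0 < \<xi>" using \<open>x \<noteq> y\<close> by (simp add: \<xi>_def)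
  note [measurable] = borel_measurable_second_gap[OF moc]
  define G where "G = enn2real (gauss_gap \<alpha>)"
  have G: "gauss_gap \<alpha> = ennreal G" "0 \<le> G" using gap by (simp_all add: G_def)
  have "0 < G" using G gauss_gap_pos[of \<alpha>] by simp
  let ?E = "\<lambda>j s. 1 - exp (- (s * norm (\<kappa> j))\<^sup>2 / 2)"
  let ?C = "\<lambda>j x. cos (\<kappa> j \<bullet> x + \<phi> j)"
  have E: "has_bochner_integral (levy_measure \<alpha>) (?E j) (norm (\<kappa> j) powr (2 * \<alpha>) * G)" for j
    by (rule has_bochner_integral_nn_integral)
       (use gauss_gap_scale[where l = "norm (\<kappa> j)" and \<alpha> = \<alpha>] G in \<open>auto simp: ennreal_mult'\<close>)
  define a where "a j s = r j * (?E j s * (?C j x - ?C j y))" for j s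
  have a: "has_bochner_integral (levy_measure \<alpha>) (a j) (r j * (norm (\<kappa> j) powr (2 * \<alpha>) * G * (?C j x - ?C j y)))" for j
    unfolding a_def by (intro has_bochner_integral_mult_right has_bochner_integral_mult_left E)
  have C2: "\<bar>?C j x - ?C j y\<bar> \<le> 2" for j
    using abs_cos_le_one[of "\<kappa> j \<bullet> x + \<phi> j"] abs_cos_le_one[of "\<kappa> j \<bullet> y + \<phi> j"] by linarith
  have E01: "0 \<le> ?E j s" "?E j s \<le> 1" for j s by auto
  have a_abs: "\<bar>a j s\<bar> \<le> 2 * r j * ?E j s" for j s
    using mult_left_mono[OF C2, of "r j * ?E j s"] r_nonneg[of j] E01[of s j]
    by (simp add: a_def abs_mult mult_ac)
  have a_sums: "summable (\<lambda>j. norm (a j s))" for s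
  proof (rule summable_comparison_test'[OF summable_mult[OF r_summable, of 2], of 0])
    fix j
    have "\<bar>a j s\<bar> \<le> 2 * r j * 1"
      using a_abs[of j s] mult_left_mono[OF E01(2)[of s j], of "2 * r j"] r_nonneg[of j] by simp
    then show "norm (norm (a j s)) \<le> 2 * r j" by simp
  qed
  have a_int: "summable (\<lambda>j. LINT s|levy_measure \<alpha>. norm (a j s))"
  proof (rule summable_comparison_test'[OF summable_mult[OF smooth, of "2 * G"], of 0])
    fix j
    have "(LINT s|levy_measure \<alpha>. \<bar>a j s\<bar>) \<le> (LINT s|levy_measure \<alpha>. 2 * r j * ?E j s)"
      using a[of j] E[of j] a_abs by (intro integral_mono) (auto simp: has_bochner_integral_iff)
    also have "\<dots> = 2 * G * (r j * norm (\<kappa> j) powr (2 * \<alpha>))"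
      using E[of j] by (simp add: has_bochner_integral_iff)
    finally show "norm (LINT s|levy_measure \<alpha>. norm (a j s)) \<le> 2 * G * (r j * norm (\<kappa> j) powr (2 * \<alpha>))"
      by (simp add: integral_nonneg_AE)
  qed
  have \<Lambda>: "summable (\<lambda>j. r j * norm (\<kappa> j) powr (2 * \<alpha>) * ?C j z)" for z
    by (rule summable_comparison_test'[OF smooth, of 0])
       (auto simp: abs_mult r_nonneg intro!: mult_left_le)
  have int: "integrable (levy_measure \<alpha>) (\<lambda>s. \<Sum>j. a j s)"
    by (rule integrable_suminf) (use a a_sums a_int in \<open>simp_all add: has_bochner_integral_iff\<close>)
  have "(LINT s|levy_measure \<alpha>. (\<Sum>j. a j s)) = (\<Sum>j. LINT s|levy_measure \<alpha>. a j s)"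
    by (rule integral_suminf) (use a a_sums a_int in \<open>simp_all add: has_bochner_integral_iff\<close>)
  also have "(\<Sum>j. LINT s|levy_measure \<alpha>. a j s) =
      (\<Sum>j. G * (r j * norm (\<kappa> j) powr (2 * \<alpha>) * ?C j x - r j * norm (\<kappa> j) powr (2 * \<alpha>) * ?C j y))"
    unfolding has_bochner_integral_integral_eq[OF a] by (simp add: algebra_simps)
  also have "\<dots> = G * (\<Lambda> x - \<Lambda> y)"
    unfolding \<Lambda>_def using \<Lambda> by (subst suminf_mult) (auto intro: summable_diff simp: suminf_diff)
  finally have total: "(LINT s|levy_measure \<alpha>. (\<Sum>j. a j s)) = G * (\<Lambda> x - \<Lambda> y)" .
  have lower: "(LINT n|std_normal_distribution. second_gap w \<xi> (s * n)) / 2 \<le> (\<Sum>j. a j s)" for s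
  proof (cases "s = 0")
    case True
    then show ?thesis
      using \<open>0 < \<xi>\<close> by (simp add: a_def second_gap_def odd_ext_nonneg_arg[OF moc])
  next
    case False
    have s1: "summable (\<lambda>j. r j * ?C j z)" for z
      by (rule summable_dominated) simp
    have s2: "summable (\<lambda>j. r j * (exp (- (s * norm (\<kappa> j))\<^sup>2 / 2) * ?C j z))" for z
      by (rule summable_dominated) (auto simp: abs_mult intro!: mult_le_one)
    have "(\<Sum>j. a j s) = (\<Sum>j. (r j * ?C j x - r j * ?C j y) -
       (r j * (exp (- (s * norm (\<kappa> j))\<^sup>2 / 2) * ?C j x) - r j * (exp (- (s * norm (\<kappa> j))\<^sup>2 / 2) * ?C j y)))"
      by (simp add: a_def algebra_simps)
    also have "\<dots> = (f x - f y) - (heat_series s x - heat_series s y)"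
      unfolding f_series heat_series_def
      by (simp only: suminf_diff summable_diff s1 s2)
    finally show ?thesis
      using heat_series_diff_le[OF moc \<open>x \<noteq> y\<close> False cont mod] touch by (simp add: \<xi>_def)
  qed
  have gap0: "0 \<le> second_gap w \<xi> s" for s
    using second_gap_nonneg[OF moc \<open>0 < \<xi>\<close>] .
  have gap_at_0: "second_gap w \<xi> 0 = 0"
    using \<open>0 < \<xi>\<close> by (simp add: second_gap_def odd_ext_nonneg_arg[OF moc])
  have nonneg: "0 \<le> (\<Sum>j. a j s)" for s
    using order.trans[OF _ lower] gap0 by (simp add: integral_nonneg_AE)
  then have "0 \<le> G * (\<Lambda> x - \<Lambda> y)"
    unfolding total[symmetric] by (simp add: integral_nonneg_AE)
  then show pos: ?pos using \<open>0 < G\<close> by (simp add: zero_le_mult_iff)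
  have "gauss_moment \<alpha> * (\<integral>\<^sup>+s. ennreal (second_gap w \<xi> s / 2) \<partial>levy_measure \<alpha>) =
      (\<integral>\<^sup>+s. \<integral>\<^sup>+n. ennreal (second_gap w \<xi> (s * n) / 2) \<partial>std_normal_distribution \<partial>levy_measure \<alpha>)"
    using gap_at_0 by (subst nn_integral_levy_gauss_scale) auto
  also have "\<dots> \<le> (\<integral>\<^sup>+s. ennreal (\<Sum>j. a j s) \<partial>levy_measure \<alpha>)"
  proof (rule nn_integral_mono)
    fix s
    have "integrable std_normal_distribution (\<lambda>n. second_gap w \<xi> (s * n))"
    proof (cases "s = 0")
      case True
      interpret N: prob_space std_normal_distribution by (rule prob_space_normal_density) simp
      show ?thesis using True by simp
    next
      case False
      show ?thesis
        by (rule gauss_reflection(1)[OF moc \<open>0 < \<xi>\<close> False, of "\<lambda>_. 0" 0])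
           (use moc in \<open>auto simp: modulus_of_continuity_def\<close>)
    qed
    then have "(\<integral>\<^sup>+n. ennreal (second_gap w \<xi> (s * n) / 2) \<partial>std_normal_distribution) =
        ennreal ((LINT n|std_normal_distribution. second_gap w \<xi> (s * n)) / 2)"
      using gap0 by (subst nn_integral_eq_integral) auto
    also have "\<dots> \<le> ennreal (\<Sum>j. a j s)"
      by (rule ennreal_leI) (rule lower)
    finally show "(\<integral>\<^sup>+n. ennreal (second_gap w \<xi> (s * n) / 2) \<partial>std_normal_distribution) \<le> ennreal (\<Sum>j. a j s)" .
  qed
  also have "\<dots> = ennreal (G * (\<Lambda> x - \<Lambda> y))"
    using nonneg int total by (subst nn_integral_eq_integral) auto
  also have "\<dots> = gauss_gap \<alpha> * ennreal (\<Lambda> x - \<Lambda> y)"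
    using pos G by (simp add: ennreal_mult)
  finally show ?le by (simp add: \<xi>_def)
qed

end

section \<open>Fourier series of smooth periodic functions\<close>

text \<open>Half open, so that a shifted cell splits into translates of pieces of the cell.\<close>

definition cell :: "real \<Rightarrow> (real ^ 'd) set" where
  "cell L = {y. \<forall>i. 0 \<le> y $ i \<and> y $ i < L}"

abbreviation cell_integral :: "real \<Rightarrow> (real ^ 'd \<Rightarrow> real) \<Rightarrow> real" where
  "cell_integral L g \<equiv> LINT y:cell L|lborel. g y"

definition lattice_points :: "(real ^ 'd) set" where
  "lattice_points = {k. \<forall>i. k $ i \<in> \<int>}"

definition wave :: "real \<Rightarrow> real ^ 'd \<Rightarrow> real \<Rightarrow> real ^ 'd \<Rightarrow> real" where
  "wave L k \<phi> y = cos ((2 * pi / L) * (k \<bullet> y) + \<phi>)"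

lemma cell_borel [measurable]: "cell L \<in> sets borel"
  unfolding cell_def by measurable

lemma cell_subset: "cell L \<subseteq> cbox 0 (\<chi> i. L)"
  by (auto simp: cell_def mem_box_cart less_imp_le)

lemma set_integrable_cell:
  fixes g :: "real ^ 'd \<Rightarrow> real"
  assumes "continuous_on UNIV g"
  shows "set_integrable lborel (cell L) g"
proof (rule set_integrable_subset)
  show "set_integrable lborel (cbox 0 (\<chi> i. L)) g"
    unfolding set_integrable_def
    by (intro borel_integrable_compact continuous_on_subset[OF assms]) auto
qed (auto simp: cell_subset)

lemma AE_cell: "AE y in lborel. y \<in> cbox 0 (\<chi> i. L) \<longleftrightarrow> (y :: real ^ 'd) \<in> cell L"
proof -
  have "AE y in lborel. \<forall>i\<in>UNIV. (y :: real ^ 'd) $ i \<noteq> L"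
  proof (subst AE_finite_all)
    show "\<forall>i\<in>UNIV. AE y in lborel. (y :: real ^ 'd) $ i \<noteq> L"
      using AE_lborel_inner_neq[of "axis i 1 :: real ^ 'd" L for i] by (auto simp: inner_axis axis_in_Basis_iff)
  qed simp
  then show ?thesis
    by (rule AE_mp) (auto simp: cell_def mem_box_cart order.order_iff_strict)
qed

lemma cbox_integral_eq_cell:
  fixes g :: "real ^ 'd \<Rightarrow> 'a::{banach, second_countable_topology}"
  assumes "continuous_on UNIV g"
  shows "(LINT y:cbox 0 (\<chi> i. L)|lborel. g y) = (LINT y:cell L|lborel. g y)"
proof -
  have [measurable]: "g \<in> borel_measurable borel"
    using assms by (rule borel_measurable_continuous_onI)
  show ?thesis
    unfolding set_lebesgue_integral_def
    by (rule integral_cong_AE) (use AE_cell[of L, where 'd = 'd] in \<open>auto split: split_indicator\<close>)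
qed

lemma cell_integral_const: "0 < L \<Longrightarrow> cell_integral L (\<lambda>_ :: real ^ 'd. c) = c * L ^ CARD('d)"
proof -
  assume "0 < L"
  have "cell_integral L (\<lambda>_ :: real ^ 'd. c) = (LINT y:(cbox 0 (\<chi> i. L) :: (real ^ 'd) set)|lborel. c)"
    by (rule cbox_integral_eq_cell[symmetric]) (rule continuous_on_const)
  also have "\<dots> = measure lborel (cbox 0 (\<chi> i. L) :: (real ^ 'd) set) * c"
    by (simp add: set_lebesgue_integral_def)
  also have "measure lborel (cbox 0 (\<chi> i. L) :: (real ^ 'd) set) = L ^ CARD('d)"
    using \<open>0 < L\<close> by (subst content_cbox_cart) (auto simp: interval_ne_empty_cart less_imp_le)
  finally show ?thesis by simp
qed

lemma integral_lborel_translate: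
  fixes g :: "'a::euclidean_space \<Rightarrow> real"
  assumes [measurable]: "g \<in> borel_measurable borel"
  shows "(LINT y|lborel. g (v + y)) = (LINT y|lborel. g y)"
  by (subst (2) lborel_distr_plus[of v, symmetric]) (simp add: integral_distr)

lemma integrable_lborel_translate:
  fixes g :: "'a::euclidean_space \<Rightarrow> real"
  assumes [measurable]: "g \<in> borel_measurable borel" and "integrable lborel g"
  shows "integrable lborel (\<lambda>y. g (v + y))"
  using assms(2) by (subst (asm) lborel_distr_plus[of v, symmetric]) (simp add: integrable_distr_eq)

lemma cell_shift_axis_nonneg:
  fixes g :: "real ^ 'd \<Rightarrow> real"
  assumes cont: "continuous_on UNIV g" and per: "periodic L g" and h: "0 \<le> h" "h \<le> L"
  shows "cell_integral L (\<lambda>y. g (y + axis i h)) = cell_integral L g"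
proof -
  have [measurable]: "g \<in> borel_measurable borel"
    using cont by (rule borel_measurable_continuous_onI)
  define A where "A = cell L \<inter> {y :: real ^ 'd. h \<le> y $ i}"
  define C where "C = cell L \<inter> {y :: real ^ 'd. y $ i < h}"
  have [measurable]: "A \<in> sets borel" "C \<in> sets borel" unfolding A_def C_def by measurable
  have int: "integrable lborel (\<lambda>y. indicator S y * g y)" if "S \<subseteq> cell L" "S \<in> sets borel" for S
    using set_integrable_subset[OF set_integrable_cell[OF cont, of L], of S] that by (simp add: set_integrable_def)
  have intA: "integrable lborel (\<lambda>y. indicator A y * g y)" and intC: "integrable lborel (\<lambda>y. indicator C y * g y)"
    by (rule int; simp add: A_def C_def)+
  have ind: "indicator (cell L) (y - axis i h) = indicator A y + (indicator C (y - axis i L) :: real)" for y :: "real ^ 'd"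
  proof -
    have "y - axis i h \<in> cell L \<longleftrightarrow> (h \<le> y $ i \<and> y $ i < L + h \<and> (\<forall>j. j \<noteq> i \<longrightarrow> 0 \<le> y $ j \<and> y $ j < L))"
      unfolding cell_def by (auto simp: axis_def)
    moreover have "y \<in> A \<longleftrightarrow> (h \<le> y $ i \<and> y $ i < L \<and> (\<forall>j. j \<noteq> i \<longrightarrow> 0 \<le> y $ j \<and> y $ j < L))"
      unfolding cell_def A_def using h by (auto intro: order.trans)
    moreover have "y - axis i L \<in> C \<longleftrightarrow> (L \<le> y $ i \<and> y $ i < L + h \<and> (\<forall>j. j \<noteq> i \<longrightarrow> 0 \<le> y $ j \<and> y $ j < L))"
    proof -
      have "(\<forall>j. 0 \<le> y $ j - axis i L $ j \<and> y $ j - axis i L $ j < L) \<longleftrightarrow>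
        (0 \<le> y $ i - L \<and> y $ i - L < L) \<and> (\<forall>j. j \<noteq> i \<longrightarrow> 0 \<le> y $ j \<and> y $ j < L)"
        by (auto simp: axis_def)
      then show ?thesis unfolding cell_def C_def using h by auto
    qed
    ultimately show ?thesis using h by (auto split: split_indicator)
  qed
  have per': "g (axis i L + y) = g y" for y
    using per by (simp add: periodic_def add.commute)
  have "cell_integral L (\<lambda>y. g (y + axis i h)) = (LINT y|lborel. indicator (cell L) y * g (axis i h + y))"
    by (simp add: set_lebesgue_integral_def add.commute)
  also have "\<dots> = (LINT y|lborel. (\<lambda>u. indicator (cell L) (u - axis i h) * g u) (axis i h + y))"
    by simp
  also have "\<dots> = (LINT u|lborel. indicator (cell L) (u - axis i h) * g u)"
    by (rule integral_lborel_translate) measurable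
  also have "\<dots> = (LINT u|lborel. indicator A u * g u + indicator C (u - axis i L) * g u)"
    unfolding ind by (simp add: distrib_right)
  also have "\<dots> = (LINT u|lborel. indicator A u * g u) + (LINT u|lborel. indicator C (u - axis i L) * g u)"
  proof (rule Bochner_Integration.integral_add[OF intA])
    have "integrable lborel (\<lambda>u. (\<lambda>y. indicator C y * g y) ((- axis i L) + u))"
      by (rule integrable_lborel_translate[OF _ intC]) measurable
    then show "integrable lborel (\<lambda>u. indicator C (u - axis i L) * g u)"
      using per'[of "u - axis i L" for u] by (simp add: add.commute)
  qed
  also have "(LINT u|lborel. indicator C (u - axis i L) * g u) = (LINT u|lborel. indicator C u * g u)"
    using integral_lborel_translate[of "\<lambda>u. indicator C (u - axis i L) * g u" "axis i L"] by (simp add: per')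
  also have "(LINT u|lborel. indicator A u * g u) + (LINT u|lborel. indicator C u * g u) =
      (LINT u|lborel. indicator A u * g u + indicator C u * g u)"
    by (rule Bochner_Integration.integral_add[OF intA intC, symmetric])
  also have "\<dots> = cell_integral L g"
    unfolding set_lebesgue_integral_def
    by (intro Bochner_Integration.integral_cong) (auto simp: A_def C_def split: split_indicator)
  finally show ?thesis .
qed

lemma periodic_axis_int:
  assumes "periodic L g"
  shows "g (x + axis i (of_int n * L)) = g x"
proof -
  have nat: "g (x + axis i (of_nat m * L)) = g x" for x and m :: nat
  proof (induction m)
    case (Suc m)
    have "axis i (of_nat (Suc m) * L) = axis i (of_nat m * L) + axis i L"
      by (simp add: vec_eq_iff axis_def algebra_simps)
    then show ?case using Suc assms by (simp add: periodic_def flip: add.assoc)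
  qed (simp add: axis_def zero_vec_def[symmetric])
  show ?thesis
  proof (cases "0 \<le> n")
    case True
    then show ?thesis using nat[of x "nat n"] by simp
  next
    case False
    have "x + axis i (of_int n * L) + axis i (of_nat (nat (- n)) * L) = x"
      using False by (simp add: vec_eq_iff axis_def)
    then show ?thesis using nat[of "x + axis i (of_int n * L)" "nat (- n)"] by metis
  qed
qed

lemma periodic_translate: "periodic L g \<Longrightarrow> periodic L (\<lambda>y. g (y + v))"
  unfolding periodic_def by (metis add.assoc add.commute)

lemma continuous_on_translate:
  fixes g :: "real ^ 'd \<Rightarrow> real"
  shows "continuous_on UNIV g \<Longrightarrow> continuous_on UNIV (\<lambda>y. g (y + v))"
  by (rule continuous_on_compose2[where f = "\<lambda>y. y + v"]) (auto intro!: continuous_intros)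

lemma cell_shift_axis:
  fixes g :: "real ^ 'd \<Rightarrow> real"
  assumes "0 < L" and cont: "continuous_on UNIV g" and per: "periodic L g"
  shows "cell_integral L (\<lambda>y. g (y + axis i h)) = cell_integral L g"
proof -
  define n where "n = \<lfloor>h / L\<rfloor>"
  define h' where "h' = h - of_int n * L"
  have "0 \<le> h / L - of_int n" "h / L - of_int n < 1"
    unfolding n_def by linarith+
  then have "0 \<le> h'" "h' \<le> L" using \<open>0 < L\<close> by (auto simp: h'_def field_simps)
  have "g (y + axis i h) = g (y + axis i h')" for y
  proof -
    have "y + axis i h = y + axis i h' + axis i (of_int n * L)"
      by (simp add: h'_def vec_eq_iff axis_def)
    then show ?thesis using periodic_axis_int[OF per] by metis
  qed
  then show ?thesis
    using cell_shift_axis_nonneg[OF cont per \<open>0 \<le> h'\<close> \<open>h' \<le> L\<close>] by simp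
qed

lemma cell_shift:
  fixes g :: "real ^ 'd \<Rightarrow> real"
  assumes "0 < L" and cont: "continuous_on UNIV g" and per: "periodic L g"
  shows "cell_integral L (\<lambda>y. g (y + v)) = cell_integral L g"
proof -
  have "cell_integral L (\<lambda>y. g (y + (\<Sum>i\<in>S. axis i (v $ i)))) = cell_integral L g" if "finite S" for S
    using that
  proof induction
    case (insert i S)
    have "cell_integral L (\<lambda>y. g (y + (\<Sum>i\<in>insert i S. axis i (v $ i)))) =
        cell_integral L (\<lambda>y. (\<lambda>u. g (u + (\<Sum>i\<in>S. axis i (v $ i)))) (y + axis i (v $ i)))"
      using insert.hyps by (simp add: add.assoc)
    also have "\<dots> = cell_integral L (\<lambda>u. g (u + (\<Sum>i\<in>S. axis i (v $ i))))"
      by (intro cell_shift_axis periodic_translate continuous_on_translate assms)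
    finally show ?case using insert.IH by simp
  qed simp
  moreover have "(\<Sum>i\<in>UNIV. axis i (v $ i)) = v"
    by (simp add: vec_eq_iff axis_def)
  ultimately show ?thesis
    by (metis finite_class.finite_UNIV)
qed

lemma wave_minus: "wave L (- k) (- \<phi>) = wave L k \<phi>"
proof
  fix y
  show "wave L (- k) (- \<phi>) y = wave L k \<phi> y"
    using cos_minus[of "(2 * pi / L) * (k \<bullet> y) + \<phi>"] by (simp add: wave_def)
qed

lemma wave_translate: "wave L k \<phi> (y + v) = wave L k (\<phi> + (2 * pi / L) * (k \<bullet> v)) y"
  by (simp add: wave_def inner_add_right algebra_simps add_divide_distrib)

lemma continuous_on_wave [continuous_intros]: "continuous_on UNIV (wave L k \<phi>)"
  unfolding wave_def by (intro continuous_intros)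

lemma abs_wave_le_1: "\<bar>wave L k \<phi> y\<bar> \<le> 1"
  by (simp add: wave_def)

lemma wave_add_pi: "wave L k (\<phi> + pi) y = - wave L k \<phi> y"
  by (simp add: wave_def cos_add flip: add.assoc)

lemma wave_periodic:
  assumes "k \<in> lattice_points" "0 < L"
  shows "periodic L (wave L k \<phi>)"
  unfolding periodic_def
proof (intro allI)
  fix x i
  obtain n :: int where n: "k $ i = of_int n"
    using assms by (auto simp: lattice_points_def Ints_def)
  have "wave L k \<phi> (x + axis i L) = cos ((2 * pi / L) * (k \<bullet> x) + \<phi> + 2 * pi * of_int n)"
    using \<open>0 < L\<close> by (simp add: wave_translate wave_def inner_axis n algebra_simps)
  then show "wave L k \<phi> (x + axis i L) = wave L k \<phi> x"
    by (simp only: cos_add cos_int_2pin sin_int_2pin wave_def) simp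
qed

lemma wave_mult: "wave L k \<phi> y * wave L l \<psi> y = (wave L (k + l) (\<phi> + \<psi>) y + wave L (k - l) (\<phi> - \<psi>) y) / 2"
  unfolding wave_def cos_times_cos by (simp add: inner_add_left inner_diff_left algebra_simps add_divide_distrib diff_divide_distrib)

lemma half_period:
  assumes "k $ i \<noteq> 0" "0 < L"
  shows "wave L k \<phi> (y + axis i (L / (2 * k $ i))) = - wave L k \<phi> y"
proof -
  have "(2 * pi / L) * (k \<bullet> axis i (L / (2 * k $ i))) = pi"
    using assms by (simp add: inner_axis)
  then show ?thesis by (simp add: wave_translate wave_add_pi)
qed

lemma wave_integral:
  fixes k :: "real ^ 'd"
  assumes "k \<in> lattice_points" "0 < L"
  shows "cell_integral L (wave L k \<phi>) = (if k = 0 then cos \<phi> * L ^ CARD('d) else 0)"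
proof (cases "k = 0")
  case True
  then have "wave L k \<phi> = (\<lambda>_. cos \<phi>)" by (simp add: wave_def fun_eq_iff)
  then show ?thesis using True cell_integral_const[OF \<open>0 < L\<close>, where 'd = 'd] by simp
next
  case False
  then obtain i where "k $ i \<noteq> 0" by (auto simp: vec_eq_iff)
  from half_period[OF this \<open>0 < L\<close>]
  have "cell_integral L (\<lambda>y. wave L k \<phi> (y + axis i (L / (2 * k $ i)))) = cell_integral L (\<lambda>y. - wave L k \<phi> y)"
    by (simp only:)
  then have "cell_integral L (wave L k \<phi>) = cell_integral L (\<lambda>y. - wave L k \<phi> y)"
    by (simp only: cell_shift[OF \<open>0 < L\<close> continuous_on_wave wave_periodic[OF assms]])
  then show ?thesis using False by (simp add: set_integral_uminus set_integrable_cell[OF continuous_on_wave])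
qed

lemma lattice_points_add: "k \<in> lattice_points \<Longrightarrow> l \<in> lattice_points \<Longrightarrow> k + l \<in> lattice_points"
  and lattice_points_diff: "k \<in> lattice_points \<Longrightarrow> l \<in> lattice_points \<Longrightarrow> k - l \<in> lattice_points"
  and lattice_points_minus: "k \<in> lattice_points \<Longrightarrow> - k \<in> lattice_points"
  and lattice_points_axis: "axis i 1 \<in> lattice_points"
  by (auto simp: lattice_points_def axis_def)

lemma wave_product_integral:
  fixes k l :: "real ^ 'd"
  assumes "k \<in> lattice_points" "l \<in> lattice_points" "0 < L"
  shows "cell_integral L (\<lambda>y. wave L k \<phi> y * wave L l \<psi> y) =
    ((if k = - l then cos (\<phi> + \<psi>) else 0) + (if k = l then cos (\<phi> - \<psi>) else 0)) / 2 * L ^ CARD('d)"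
proof -
  have "cell_integral L (\<lambda>y. wave L k \<phi> y * wave L l \<psi> y) =
      (cell_integral L (wave L (k + l) (\<phi> + \<psi>)) + cell_integral L (wave L (k - l) (\<phi> - \<psi>))) / 2"
    unfolding wave_mult by (simp add: set_integral_add set_integrable_cell continuous_on_wave)
  then show ?thesis
    using assms by (simp add: wave_integral lattice_points_add lattice_points_diff eq_neg_iff_add_eq_0 field_simps)
qed

lemma cell_integral_linear:
  fixes f g :: "real ^ 'd \<Rightarrow> real"
  assumes "continuous_on UNIV f" "continuous_on UNIV g"
  shows "cell_integral L (\<lambda>y. a * f y + b * g y) = a * cell_integral L f + b * cell_integral L g"
  using set_integrable_cell[OF assms(1), of L] set_integrable_cell[OF assms(2), of L]
  by (subst set_integral_add) (auto simp: set_integral_mult_right)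

lemma cell_integral_sum:
  fixes f :: "'i \<Rightarrow> real ^ 'd \<Rightarrow> real"
  assumes "\<And>i. i \<in> S \<Longrightarrow> continuous_on UNIV (f i)"
  shows "cell_integral L (\<lambda>y. \<Sum>i\<in>S. f i y) = (\<Sum>i\<in>S. cell_integral L (f i))"
  using assms
proof (induction S rule: infinite_finite_induct)
  case (insert i S)
  have "continuous_on UNIV (\<lambda>y. \<Sum>i\<in>S. f i y)"
    using insert.prems by (intro continuous_on_sum) auto
  then show ?case
    using insert cell_integral_linear[of "f i" "\<lambda>y. \<Sum>i\<in>S. f i y" L 1 1] by simp
qed (auto simp: set_lebesgue_integral_def)

text \<open>Large powers of the peak concentrate at the centre of the cell, and multiplication by it preserves
  orthogonality to all waves.\<close>

definition peak :: "real \<Rightarrow> real \<Rightarrow> real \<Rightarrow> real ^ 'd \<Rightarrow> real" where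
  "peak L a b y = a - b * (\<Sum>i\<in>UNIV. wave L (axis i 1) 0 y)"

lemma continuous_on_peak [continuous_intros]: "continuous_on UNIV (peak L a b)"
  unfolding peak_def by (intro continuous_intros)

lemma peak_power_orthogonal:
  fixes h :: "real ^ 'd \<Rightarrow> real"
  assumes cont: "continuous_on UNIV h" and "k \<in> lattice_points"
    and orth: "\<And>k \<phi>. k \<in> lattice_points \<Longrightarrow> cell_integral L (\<lambda>y. h y * wave L k \<phi> y) = 0"
  shows "cell_integral L (\<lambda>y. h y * peak L a b y ^ n * wave L k \<phi> y) = 0"
  using assms(2)
proof (induction n arbitrary: k \<phi>)
  case 0
  then show ?case using orth by simp
next
  case (Suc n)
  let ?g = "\<lambda>k \<phi> y. h y * peak L a b y ^ n * wave L k \<phi> y"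
  have g_cont: "continuous_on UNIV (?g k \<phi>)" for k \<phi>
    by (intro continuous_intros cont)
  let ?S = "\<lambda>y. \<Sum>i\<in>UNIV. (1/2) * ?g (k + axis i 1) \<phi> y + (1/2) * ?g (k - axis i 1) \<phi> y"
  have S_cont: "continuous_on UNIV ?S" by (intro continuous_intros g_cont)
  have "h y * peak L a b y ^ Suc n * wave L k \<phi> y = a * ?g k \<phi> y + (- b) * ?S y" for y
  proof -
    have "?S y = h y * peak L a b y ^ n * (\<Sum>i\<in>UNIV. wave L k \<phi> y * wave L (axis i 1) 0 y)"
      unfolding wave_mult by (simp add: sum_distrib_left algebra_simps add_divide_distrib)
    also have "(\<Sum>i\<in>UNIV. wave L k \<phi> y * wave L (axis i 1) 0 y) = wave L k \<phi> y * (\<Sum>i\<in>UNIV. wave L (axis i 1) 0 y)"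
      by (simp add: sum_distrib_left)
    finally show ?thesis by (simp add: peak_def algebra_simps)
  qed
  then have "cell_integral L (\<lambda>y. h y * peak L a b y ^ Suc n * wave L k \<phi> y) =
      a * cell_integral L (?g k \<phi>) + (- b) * cell_integral L ?S"
    using cell_integral_linear[OF g_cont S_cont, of L a k \<phi> "- b"] by simp
  also have "cell_integral L ?S = (\<Sum>i\<in>UNIV. cell_integral L (\<lambda>y. (1/2) * ?g (k + axis i 1) \<phi> y + (1/2) * ?g (k - axis i 1) \<phi> y))"
    by (intro cell_integral_sum continuous_intros g_cont)
  also have "\<dots> = 0"
    unfolding cell_integral_linear[OF g_cont g_cont]
    using Suc.prems by (simp add: Suc.IH lattice_points_add lattice_points_diff lattice_points_axis)
  finally show ?case using Suc by simp
qed

lemma sum_cos_minimum: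
  fixes y :: "real ^ 'd"
  assumes "0 < L" "y \<in> cbox 0 (\<chi> i. L)" "y \<noteq> (\<chi> i. L / 2)"
  shows "- real CARD('d) < (\<Sum>i\<in>UNIV. wave L (axis i 1) 0 y)"
proof -
  obtain i where i: "y $ i \<noteq> L / 2" using assms by (auto simp: vec_eq_iff)
  have "- 1 < wave L (axis i 1) 0 y"
  proof (rule ccontr)
    assume "\<not> ?thesis"
    then have "cos (2 * pi / L * y $ i) = - 1"
      using cos_ge_minus_one[of "2 * pi / L * y $ i"] by (simp add: wave_def inner_axis' del: cos_ge_minus_one)
    then obtain n :: int where n: "2 * pi / L * y $ i = (2 * of_int n + 1) * pi"
      using cos_eq_minus1 by metis
    then have "pi * (2 * y $ i) = pi * ((2 * of_int n + 1) * L)"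
      using \<open>0 < L\<close> by (simp add: field_simps)
    then have "2 * y $ i = (2 * of_int n + 1) * L"
      by (simp only: mult_cancel_left pi_neq_zero simp_thms)
    moreover have "0 \<le> y $ i" "y $ i \<le> L" using assms by (auto simp: mem_box_cart)
    ultimately have "0 \<le> (2 * of_int n + 1) * L" "(2 * of_int n + 1) * L \<le> 2 * L" by auto
    then have "0 \<le> (2 * real_of_int n + 1)" "(2 * real_of_int n + 1) \<le> 2"
      using \<open>0 < L\<close> by (auto simp: zero_le_mult_iff)
    then have "n = 0" by linarith
    then show False using n i \<open>0 < L\<close> by (simp add: field_simps)
  qed
  moreover have "- 1 \<le> wave L (axis j 1) 0 y" for j
    using abs_wave_le_1[of L "axis j 1" 0 y] by (simp add: abs_le_iff)
  ultimately have "(\<Sum>i\<in>(UNIV :: 'd set). - 1) < (\<Sum>i\<in>UNIV. wave L (axis i 1) 0 y)"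
    by (intro sum_strict_mono_ex1 ballI bexI[of _ i]) auto
  then show ?thesis by simp
qed

lemma orthogonal_imp_not_pos:
  fixes h :: "real ^ 'd \<Rightarrow> real"
  assumes "0 < L" and cont: "continuous_on UNIV h" and pos: "0 < h (\<chi> i. L / 2)"
    and orth: "\<And>k \<phi>. k \<in> lattice_points \<Longrightarrow> cell_integral L (\<lambda>y. h y * wave L k \<phi> y) = 0"
  shows False
proof -
  define p :: "real ^ 'd" where "p = (\<chi> i. L / 2)"
  define d where "d = real CARD('d)"
  have "0 < d" by (simp add: d_def)
  define s :: "real ^ 'd \<Rightarrow> real" where "s y = d + (\<Sum>i\<in>UNIV. wave L (axis i 1) 0 y)" for y
  have s_cont: "continuous_on UNIV s" unfolding s_def by (intro continuous_intros)
  have s_le: "s y \<le> 2 * d" for y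
    using sum_mono[of UNIV "\<lambda>i. wave L (axis i 1) 0 y" "\<lambda>_. 1"] abs_wave_le_1[of L "axis i 1" 0 y for i]
    by (simp add: s_def d_def abs_le_iff)
  have s_p: "s p = 0"
    using \<open>0 < L\<close> by (simp add: s_def p_def d_def wave_def inner_axis')
  have s_pos: "0 < s y" if "y \<in> cbox 0 (\<chi> i. L)" "y \<noteq> p" for y
    using sum_cos_minimum[OF \<open>0 < L\<close> that(1)] that(2) by (simp add: s_def d_def p_def)
  have hp: "0 < h p" using pos by (simp add: p_def)
  obtain \<delta> where "0 < \<delta>" and \<delta>: "\<And>y. dist y p < \<delta> \<Longrightarrow> h p / 2 < h y"
  proof -
    have "isCont h p" using cont by (simp add: continuous_on_eq_continuous_at)
    then obtain \<delta> where "0 < \<delta>" "\<And>y. dist y p < \<delta> \<Longrightarrow> dist (h y) (h p) < h p / 2"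
      using hp unfolding continuous_at_eps_delta by (metis half_gt_zero)
    moreover have "h p / 2 < u" if "dist u (h p) < h p / 2" for u
      using that by (simp add: dist_real_def abs_if field_simps split: if_splits)
    ultimately show ?thesis using that by blast
  qed
  let ?K = "cbox 0 (\<chi> i. L) - ball p \<delta>"
  obtain \<epsilon> where "0 < \<epsilon>" and \<epsilon>: "\<And>y. y \<in> ?K \<Longrightarrow> \<epsilon> \<le> s y"
  proof (cases "?K = {}")
    case True
    then show ?thesis by (intro that[of 1]) auto
  next
    case False
    have "compact ?K" by (intro compact_diff compact_cbox open_ball)
    then obtain y0 where "y0 \<in> ?K" "\<And>y. y \<in> ?K \<Longrightarrow> s y0 \<le> s y"
      using continuous_attains_inf[of ?K s] False continuous_on_subset[OF s_cont] by blast
    moreover have "y0 \<noteq> p" using \<open>y0 \<in> ?K\<close> \<open>0 < \<delta>\<close> by auto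
    ultimately show ?thesis using s_pos[of y0] by (intro that[of "s y0"]) auto
  qed
  obtain \<rho> where "0 < \<rho>" and \<rho>: "ball p \<rho> \<subseteq> cell L" "ball p \<rho> \<subseteq> ball p \<delta>" "\<And>y. y \<in> ball p \<rho> \<Longrightarrow> s y < \<epsilon> / 2"
  proof -
    let ?U = "box 0 (\<chi> i. L) \<inter> ball p \<delta> \<inter> {y :: real ^ 'd. s y < \<epsilon> / 2}"
    have "open ?U"
      by (intro open_Int open_box open_ball open_Collect_less s_cont continuous_intros)
    moreover have "p \<in> ?U"
      using \<open>0 < L\<close> \<open>0 < \<delta>\<close> \<open>0 < \<epsilon>\<close> s_p by (simp add: p_def mem_box_cart)
    ultimately obtain \<rho> where "0 < \<rho>" "ball p \<rho> \<subseteq> ?U" by (meson open_contains_ball)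
    then show ?thesis by (intro that[of \<rho>]) (auto simp: cell_def mem_box_cart less_imp_le)
  qed
  define T :: "real ^ 'd \<Rightarrow> real" where "T = peak L (1 + \<epsilon> / d - 1) (1 / d)"
  have T: "T y = 1 + (\<epsilon> - s y) / d" for y :: "real ^ 'd"
    using \<open>0 < d\<close> by (simp add: T_def peak_def s_def field_simps)
  have T_cont: "continuous_on UNIV T" unfolding T_def by (intro continuous_intros)
  define q where "q = 1 + \<epsilon> / (2 * d)"
  have "1 < q" using \<open>0 < \<epsilon>\<close> \<open>0 < d\<close> by (simp add: q_def)
  obtain B where B: "\<And>y. y \<in> cell L \<Longrightarrow> \<bar>h y\<bar> \<le> B"
  proof -
    have "bounded (h ` cbox 0 (\<chi> i. L))"
      by (intro compact_imp_bounded compact_continuous_image continuous_on_subset[OF cont]) auto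
    then show ?thesis
      using that cell_subset[of L] by (force simp: bounded_iff)
  qed
  have "0 \<le> B" using B[of p] \<rho>(1) \<open>0 < \<rho>\<close> by force
  define m where "m = measure lborel (ball p \<rho>)"
  have "0 < m" using \<open>0 < \<rho>\<close> content_ball_pos[of \<rho> p] by (simp add: m_def)
  have ball_int: "set_integrable lborel (cell L) (\<lambda>y. indicator (ball p \<rho>) y :: real)"
    using set_integrable_subset[OF set_integrable_cell[of "\<lambda>_. 1" L], of "ball p \<rho>"] \<rho>(1)
    by (simp add: set_integrable_def indicator_inter_arith[symmetric] Int_absorb1 mult.commute)
  have const_int: "set_integrable lborel (cell L) (\<lambda>_ :: real ^ 'd. B)"
    by (rule set_integrable_cell) simp
  have bound: "(h p / 2) * q ^ (2 * n) * m \<le> B * L ^ CARD('d)" for n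
  proof -
    have point: "(h p / 2) * q ^ (2 * n) * indicator (ball p \<rho>) y - B \<le> h y * T y ^ (2 * n)" if "y \<in> cell L" for y
    proof (cases "y \<in> ball p \<delta>")
      case True
      then have "h p / 2 < h y" using \<delta>[of y] by (simp add: dist_commute)
      show ?thesis
      proof (cases "y \<in> ball p \<rho>")
        case True
        then have "\<epsilon> / 2 \<le> \<epsilon> - s y" using \<rho>(3)[of y] by simp
        then have "q \<le> T y" using \<open>0 < d\<close> by (simp add: q_def T field_simps)
        then have "q ^ (2 * n) \<le> T y ^ (2 * n)" using \<open>1 < q\<close> by (intro power_mono) auto
        then have "(h p / 2) * q ^ (2 * n) \<le> h y * T y ^ (2 * n)"
          using \<open>h p / 2 < h y\<close> hp \<open>1 < q\<close> by (intro mult_mono) auto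
        then show ?thesis using True \<open>0 \<le> B\<close> by simp
      next
        case False
        have "0 \<le> h y * T y ^ (2 * n)" using \<open>h p / 2 < h y\<close> hp by (simp add: power_mult)
        then show ?thesis using False \<open>0 \<le> B\<close> by simp
      qed
    next
      case False
      then have "\<epsilon> \<le> s y" using \<epsilon>[of y] that cell_subset[of L] by auto
      then have "T y \<le> 1" "- 1 \<le> T y"
        using s_le[of y] \<open>0 < d\<close> \<open>0 < \<epsilon>\<close> by (auto simp: T field_simps)
      then have "\<bar>T y ^ (2 * n)\<bar> \<le> 1" unfolding power_abs by (intro power_le_one) auto
      then have "\<bar>h y * T y ^ (2 * n)\<bar> \<le> B * 1"
        unfolding abs_mult using B[OF that] \<open>0 \<le> B\<close> by (intro mult_mono) auto
      moreover have "y \<notin> ball p \<rho>" using False \<rho>(2) by blast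
      ultimately show ?thesis by (simp add: abs_le_iff)
    qed
    have "(LINT y:cell L|lborel. (h p / 2) * q ^ (2 * n) * indicator (ball p \<rho>) y - B) \<le> cell_integral L (\<lambda>y. h y * T y ^ (2 * n))"
    proof (rule set_integral_mono)
      show "set_integrable lborel (cell L) (\<lambda>y. h y * T y ^ (2 * n))"
        by (intro set_integrable_cell continuous_intros cont T_cont)
      show "set_integrable lborel (cell L) (\<lambda>y. (h p / 2) * q ^ (2 * n) * indicator (ball p \<rho>) y - B)"
        by (intro set_integral_diff set_integrable_mult_right ball_int const_int)
    qed (use point in auto)
    also have "cell_integral L (\<lambda>y. h y * T y ^ (2 * n)) = 0"
    proof -
      have "wave L 0 0 = (\<lambda>_ :: real ^ 'd. 1)" by (simp add: wave_def fun_eq_iff)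
      moreover have "(0 :: real ^ 'd) \<in> lattice_points" by (simp add: lattice_points_def)
      ultimately show ?thesis
        using peak_power_orthogonal[OF cont _ orth, of 0 "1 + \<epsilon> / d - 1" "1 / d" "2 * n" 0] by (simp add: T_def)
    qed
    finally have "(LINT y:cell L|lborel. (h p / 2) * q ^ (2 * n) * indicator (ball p \<rho>) y - B) \<le> 0" .
    also have "(LINT y:cell L|lborel. (h p / 2) * q ^ (2 * n) * indicator (ball p \<rho>) y - B) =
      (h p / 2) * q ^ (2 * n) * m - B * L ^ CARD('d)"
    proof -
      have "(LINT y:cell L|lborel. indicator (ball p \<rho>) y) = m"
        using \<rho>(1) by (simp add: set_lebesgue_integral_def indicator_inter_arith[symmetric] Int_absorb1 m_def)
      then have "(LINT y:cell L|lborel. (h p / 2) * q ^ (2 * n) * indicator (ball p \<rho>) y) = (h p / 2) * q ^ (2 * n) * m"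
        by (simp add: set_integral_mult_right)
      then show ?thesis
        using set_integral_diff(2)[OF set_integrable_mult_right[OF ball_int] const_int, of "(h p / 2) * q ^ (2 * n)"] cell_integral_const[OF \<open>0 < L\<close>, of B, where 'd = 'd] by simp
    qed
    finally show ?thesis by simp
  qed
  obtain n where "2 * B * L ^ CARD('d) / (h p * m) < q ^ n"
    using real_arch_pow[OF \<open>1 < q\<close>] by blast
  also have "q ^ n \<le> q ^ (2 * n)" using \<open>1 < q\<close> by (intro power_increasing) auto
  finally show False
    using bound[of n] hp \<open>0 < m\<close> by (simp add: field_simps)
qed

lemma orthogonal_imp_zero:
  fixes h :: "real ^ 'd \<Rightarrow> real"
  assumes "0 < L" and cont: "continuous_on UNIV h" and per: "periodic L h"
    and orth: "\<And>k \<phi>. k \<in> lattice_points \<Longrightarrow> cell_integral L (\<lambda>y. h y * wave L k \<phi> y) = 0"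
  shows "h x = 0"
proof (rule ccontr)
  assume "h x \<noteq> 0"
  define v where "v = x - (\<chi> i. L / 2)"
  define g where "g y = sgn (h x) * h (y + v)" for y
  have "cell_integral L (\<lambda>y. g y * wave L k \<phi> y) = 0" if "k \<in> lattice_points" for k \<phi>
  proof -
    let ?\<psi> = "\<phi> - (2 * pi / L) * (k \<bullet> v)"
    have *: "g y * wave L k \<phi> y = sgn (h x) * (\<lambda>u. h u * wave L k ?\<psi> u) (y + v)" for y
      unfolding g_def wave_translate by simp
    have "cell_integral L (\<lambda>y. g y * wave L k \<phi> y) = sgn (h x) * cell_integral L (\<lambda>y. (\<lambda>u. h u * wave L k ?\<psi> u) (y + v))"
      unfolding * by (rule set_integral_mult_right)
    also have "cell_integral L (\<lambda>y. (\<lambda>u. h u * wave L k ?\<psi> u) (y + v)) = cell_integral L (\<lambda>u. h u * wave L k ?\<psi> u)"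
      using per wave_periodic[OF that \<open>0 < L\<close>, of ?\<psi>]
      by (intro cell_shift \<open>0 < L\<close> continuous_intros cont) (simp add: periodic_def)
    finally show ?thesis using orth[OF that] by simp
  qed
  moreover have "continuous_on UNIV g"
    unfolding g_def by (intro continuous_intros continuous_on_translate cont)
  moreover have "0 < g (\<chi> i. L / 2)"
    using \<open>h x \<noteq> 0\<close> by (auto simp: g_def v_def sgn_if)
  ultimately show False
    using orthogonal_imp_not_pos[OF \<open>0 < L\<close>, of g] by blast
qed

lemma periodic_sum_axis_int:
  assumes "periodic L g" "finite S"
  shows "g (x + (\<Sum>i\<in>S. axis i (of_int (n i) * L))) = g x"
  using assms(2)
proof induction
  case (insert i S)
  have "g (x + (\<Sum>i\<in>insert i S. axis i (of_int (n i) * L))) =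
      g ((x + (\<Sum>i\<in>S. axis i (of_int (n i) * L))) + axis i (of_int (n i) * L))"
    using insert.hyps by (simp add: ac_simps)
  then show ?case using insert.IH periodic_axis_int[OF assms(1)] by simp
qed simp

lemma periodic_bounded:
  fixes g :: "real ^ 'd \<Rightarrow> real"
  assumes "0 < L" and cont: "continuous_on UNIV g" and per: "periodic L g"
  obtains B where "\<And>y. \<bar>g y\<bar> \<le> B"
proof -
  have "bounded (g ` cbox 0 (\<chi> i. L))"
    by (intro compact_imp_bounded compact_continuous_image continuous_on_subset[OF cont]) auto
  then obtain B where B: "\<And>y. y \<in> cbox 0 (\<chi> i. L) \<Longrightarrow> \<bar>g y\<bar> \<le> B"
    by (auto simp: bounded_iff)
  have "\<bar>g y\<bar> \<le> B" for y
  proof -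
    define n where "n i = \<lfloor>y $ i / L\<rfloor>" for i
    define z where "z = (\<chi> i. y $ i - of_int (n i) * L)"
    have frac: "0 \<le> y $ i / L - of_int (n i)" "y $ i / L - of_int (n i) \<le> 1" for i
      unfolding n_def by linarith+
    have "0 \<le> y $ i - of_int (n i) * L" "y $ i - of_int (n i) * L \<le> L" for i
      using frac[of i] \<open>0 < L\<close> by (simp_all add: field_simps)
    then have "z \<in> cbox 0 (\<chi> i. L)" by (simp add: z_def mem_box_cart)
    moreover have "y = z + (\<Sum>i\<in>UNIV. axis i (of_int (n i) * L))"
      by (simp add: vec_eq_iff z_def axis_def)
    ultimately show ?thesis
      using B periodic_sum_axis_int[OF per, of UNIV z n] by simp
  qed
  then show ?thesis by (rule that)
qed

definition shift_diff :: "'d \<Rightarrow> real \<Rightarrow> (real ^ 'd \<Rightarrow> real) \<Rightarrow> real ^ 'd \<Rightarrow> real" where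
  "shift_diff i h g y = g (y + axis i h) - g y"

lemma shift_diff_power_Suc:
  "(shift_diff i h ^^ Suc m) g y = (shift_diff i h ^^ m) g (y + axis i h) - (shift_diff i h ^^ m) g y"
  by (simp add: shift_diff_def)

lemma shift_diff_power_deriv:
  assumes "\<And>y t. ((\<lambda>t. g (y + axis i t)) has_real_derivative g' (y + axis i t)) (at t)"
  shows "((\<lambda>t. (shift_diff i h ^^ m) g (y + axis i t)) has_real_derivative (shift_diff i h ^^ m) g' (y + axis i t)) (at t)"
proof (induction m arbitrary: y t)
  case 0
  then show ?case using assms by simp
next
  case (Suc m)
  have "y + axis i t + axis i h = (y + axis i h) + axis i t" for t
    by (simp add: ac_simps)
  then show ?case
    using DERIV_diff[OF Suc[of "y + axis i h" t] Suc[of y t]] by (simp only: shift_diff_power_Suc)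
qed

lemma Ck_on_partial:
  fixes g :: "real ^ 'd \<Rightarrow> real"
  assumes "Ck_on (Suc m) UNIV g" "periodic L g"
  obtains g' where "Ck_on m UNIV g'" "periodic L g'"
    "\<And>y t. ((\<lambda>t. g (y + axis i t)) has_real_derivative g' (y + axis i t)) (at t)"
proof -
  obtain f' where d: "\<And>z. (g has_derivative (\<lambda>h. \<Sum>b\<in>Basis. f' b z * (h \<bullet> b))) (at z)"
    and f': "\<And>b. b \<in> Basis \<Longrightarrow> Ck_on m UNIV (f' b)"
    using assms(1) by auto
  let ?b = "axis i 1 :: real ^ 'd"
  have b: "?b \<in> Basis" by (simp add: axis_in_Basis_iff)
  have eval: "(\<Sum>b\<in>Basis. f' b z * (axis i s \<bullet> b)) = f' ?b z * s" for z s
  proof -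
    have "axis i s = s *\<^sub>R ?b" by (simp add: vec_eq_iff axis_def)
    then have "(\<Sum>b\<in>Basis. f' b z * (axis i s \<bullet> b)) = (\<Sum>b\<in>Basis. if b = ?b then f' b z * s else 0)"
      using b by (intro sum.cong) (auto simp: inner_Basis)
    then show ?thesis using b by simp
  qed
  have line: "((\<lambda>t. g (y + axis i t)) has_real_derivative f' ?b (y + axis i t)) (at t)" for y t
  proof -
    have "((\<lambda>t. y + axis i t) has_derivative axis i) (at t)"
    proof -
      define lin where "lin t = t *\<^sub>R ?b" for t
      have ax: "axis i = lin" by (auto simp: vec_eq_iff axis_def lin_def)
      have "((\<lambda>t. y + lin t) has_derivative lin) (at t)"
        unfolding lin_def by (auto intro!: derivative_eq_intros)
      then show ?thesis by (simp only: ax)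
    qed
    from diff_chain_at[OF this d]
    show ?thesis by (simp add: has_field_derivative_def o_def eval mult_commute_abs)
  qed
  have "periodic L (f' ?b)"
    unfolding periodic_def
  proof (intro allI)
    fix x j
    have "(\<lambda>t. g (x + axis j L + axis i t)) = (\<lambda>t. g (x + axis i t))"
    proof
      fix t
      have "x + axis j L + axis i t = (x + axis i t) + axis j L" by (simp add: ac_simps)
      then show "g (x + axis j L + axis i t) = g (x + axis i t)"
        using assms(2) by (simp only: periodic_def)
    qed
    then have "((\<lambda>t. g (x + axis i t)) has_real_derivative f' ?b (x + axis j L + axis i 0)) (at 0)"
      using line[of "x + axis j L" 0] by simp
    from DERIV_unique[OF this line[of x 0]]
    show "f' ?b (x + axis j L) = f' ?b x" by (simp add: axis_def zero_vec_def[symmetric])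
  qed
  from that[OF f'[OF b] this line] show ?thesis .
qed

lemma shift_diff_power_bound:
  fixes g :: "real ^ 'd \<Rightarrow> real"
  assumes "0 < L" "Ck_on m UNIV g" "periodic L g"
  shows "\<exists>C. \<forall>h y. \<bar>(shift_diff i h ^^ m) g y\<bar> \<le> C * \<bar>h\<bar> ^ m"
  using assms(2,3)
proof (induction m arbitrary: g)
  case 0
  then obtain B where "\<And>y. \<bar>g y\<bar> \<le> B" using periodic_bounded[OF \<open>0 < L\<close>, of g] by auto
  then show ?case by auto
next
  case (Suc m)
  obtain g' where g': "Ck_on m UNIV g'" "periodic L g'"
    and line: "\<And>y t. ((\<lambda>t. g (y + axis i t)) has_real_derivative g' (y + axis i t)) (at t)"
    using Ck_on_partial[OF Suc.prems, of i] by metis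
  obtain C where C: "\<And>h y. \<bar>(shift_diff i h ^^ m) g' y\<bar> \<le> C * \<bar>h\<bar> ^ m"
    using Suc.IH[OF g'] by metis
  have "\<bar>(shift_diff i h ^^ Suc m) g y\<bar> \<le> C * \<bar>h\<bar> ^ Suc m" for h y
  proof -
    let ?F = "\<lambda>t. (shift_diff i h ^^ m) g (y + axis i t)"
    have "norm (?F h - ?F 0) \<le> (C * \<bar>h\<bar> ^ m) * norm (h - 0)"
      by (rule field_differentiable_bound[where S = UNIV and f' = "\<lambda>t. (shift_diff i h ^^ m) g' (y + axis i t)"])
         (use C in \<open>auto intro: shift_diff_power_deriv[OF line]\<close>)
    then show ?thesis by (simp add: shift_diff_power_Suc axis_def zero_vec_def[symmetric] mult_ac del: funpow.simps)
  qed
  then show ?case by blast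
qed

lemma wave_integral_shift_diff:
  fixes g :: "real ^ 'd \<Rightarrow> real"
  assumes "0 < L" "continuous_on UNIV g" "periodic L g" "k \<in> lattice_points" "k $ i \<noteq> 0"
  shows "cell_integral L (\<lambda>y. shift_diff i (L / (2 * k $ i)) g y * wave L k \<phi> y) =
    - 2 * cell_integral L (\<lambda>y. g y * wave L k \<phi> y)"
proof -
  let ?h = "L / (2 * k $ i)"
  let ?w = "\<lambda>y. g y * wave L k \<phi> y"
  have w: "continuous_on UNIV ?w" by (intro continuous_intros assms)
  have "periodic L ?w" using assms wave_periodic[of k L \<phi>] by (simp add: periodic_def)
  then have s: "cell_integral L (\<lambda>y. ?w (y + axis i ?h)) = cell_integral L ?w"
    by (intro cell_shift assms w)
  have "shift_diff i ?h g y * wave L k \<phi> y = (-1) * ?w (y + axis i ?h) + (-1) * ?w y" for y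
    using half_period[OF assms(5) \<open>0 < L\<close>, of \<phi> y] by (simp add: shift_diff_def algebra_simps)
  then have "cell_integral L (\<lambda>y. shift_diff i ?h g y * wave L k \<phi> y) =
      (-1) * cell_integral L (\<lambda>y. ?w (y + axis i ?h)) + (-1) * cell_integral L ?w"
    using cell_integral_linear[OF continuous_on_translate[OF w] w, of L "-1" "axis i ?h" "-1"] by simp
  then show ?thesis using s by simp
qed

lemma abs_cell_integral_le:
  fixes g :: "real ^ 'd \<Rightarrow> real"
  assumes "0 < L" "continuous_on UNIV g" "\<And>y. \<bar>g y\<bar> \<le> B"
  shows "\<bar>cell_integral L g\<bar> \<le> B * L ^ CARD('d)"
proof -
  have "\<bar>cell_integral L g\<bar> \<le> cell_integral L (\<lambda>y. \<bar>g y\<bar>)"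
    using set_integral_norm_bound[OF set_integrable_cell[OF assms(2), of L]] by simp
  also have "\<dots> \<le> cell_integral L (\<lambda>_ :: real ^ 'd. B)"
    by (intro set_integral_mono set_integrable_cell continuous_intros assms)
  finally show ?thesis using cell_integral_const[OF \<open>0 < L\<close>, of B, where 'd = 'd] by simp
qed

lemma wave_integral_decay:
  fixes g :: "real ^ 'd \<Rightarrow> real"
  assumes "0 < L" and Ck: "Ck_on m UNIV g" and cont: "continuous_on UNIV g" and per: "periodic L g"
  obtains C where "\<And>k \<phi>. k \<in> lattice_points \<Longrightarrow> \<bar>k $ i\<bar> ^ m * \<bar>cell_integral L (\<lambda>y. g y * wave L k \<phi> y)\<bar> \<le> C"
proof -
  obtain C where C: "\<And>h y. \<bar>(shift_diff i h ^^ m) g y\<bar> \<le> C * \<bar>h\<bar> ^ m"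
    using shift_diff_power_bound[OF \<open>0 < L\<close> Ck per, of i] by metis
  have "0 \<le> C" using C[of 1] by (metis abs_ge_zero abs_one mult.right_neutral order.trans power_one)
  have sd: "continuous_on UNIV ((shift_diff i h ^^ n) g)" "periodic L ((shift_diff i h ^^ n) g)" for h n
  proof (induction n)
    case (Suc n)
    { case 1 show ?case
        using Suc by (simp add: shift_diff_def[abs_def]) (intro continuous_intros continuous_on_translate) }
    { case 2 show ?case
        using Suc(2) periodic_translate[OF Suc(2), of "axis i h"] by (simp add: shift_diff_def periodic_def) }
  qed (use cont per in auto)
  obtain B where B: "\<And>y. \<bar>g y\<bar> \<le> B" using periodic_bounded[OF \<open>0 < L\<close> cont per] by auto
  let ?C = "C * (L / 2) ^ m * L ^ CARD('d) + B * L ^ CARD('d)"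
  have "\<bar>k $ i\<bar> ^ m * \<bar>cell_integral L (\<lambda>y. g y * wave L k \<phi> y)\<bar> \<le> ?C" if k: "k \<in> lattice_points" for k \<phi>
  proof (cases "k $ i = 0")
    case True
    have "\<bar>cell_integral L (\<lambda>y. g y * wave L k \<phi> y)\<bar> \<le> B * L ^ CARD('d)"
    proof (rule abs_cell_integral_le[OF \<open>0 < L\<close>])
      show "\<bar>g y * wave L k \<phi> y\<bar> \<le> B" for y
        using mult_mono[OF B[of y] abs_wave_le_1[of L k \<phi> y]] B[of y] by (simp add: abs_mult)
    qed (intro continuous_intros cont)
    then have "\<bar>k $ i\<bar> ^ m * \<bar>cell_integral L (\<lambda>y. g y * wave L k \<phi> y)\<bar> \<le> B * L ^ CARD('d)"
      using True by (cases m) auto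
    then show ?thesis using \<open>0 \<le> C\<close> \<open>0 < L\<close> by (simp add: add_increasing)
  next
    case False
    define h where "h = L / (2 * k $ i)"
    have "\<bar>cell_integral L (\<lambda>y. g y * wave L k \<phi> y)\<bar> \<le> \<bar>cell_integral L (\<lambda>y. (shift_diff i h ^^ n) g y * wave L k \<phi> y)\<bar>" for n
    proof (induction n)
      case (Suc n)
      have "cell_integral L (\<lambda>y. (shift_diff i h ^^ Suc n) g y * wave L k \<phi> y) =
          - 2 * cell_integral L (\<lambda>y. (shift_diff i h ^^ n) g y * wave L k \<phi> y)"
        using wave_integral_shift_diff[OF \<open>0 < L\<close> sd[of n h] k False] by (simp add: h_def)
      then show ?case using Suc by simp
    qed simp
    also have "\<bar>cell_integral L (\<lambda>y. (shift_diff i h ^^ m) g y * wave L k \<phi> y)\<bar> \<le> (C * \<bar>h\<bar> ^ m) * L ^ CARD('d)"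
    proof (rule abs_cell_integral_le[OF \<open>0 < L\<close>])
      show "\<bar>(shift_diff i h ^^ m) g y * wave L k \<phi> y\<bar> \<le> C * \<bar>h\<bar> ^ m" for y
        using mult_mono[OF C[of h y] abs_wave_le_1[of L k \<phi> y]] \<open>0 \<le> C\<close> by (simp add: abs_mult)
    qed (intro continuous_intros sd)
    finally have "\<bar>k $ i\<bar> ^ m * \<bar>cell_integral L (\<lambda>y. g y * wave L k \<phi> y)\<bar> \<le> \<bar>k $ i\<bar> ^ m * ((C * \<bar>h\<bar> ^ m) * L ^ CARD('d))"
      by (intro mult_left_mono) auto
    also have "\<dots> = C * (\<bar>k $ i\<bar> * \<bar>h\<bar>) ^ m * L ^ CARD('d)"
      by (simp add: power_mult_distrib mult_ac)
    also have "\<bar>k $ i\<bar> * \<bar>h\<bar> = L / 2"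
      using False \<open>0 < L\<close> by (simp add: h_def abs_mult)
    finally have "\<bar>k $ i\<bar> ^ m * \<bar>cell_integral L (\<lambda>y. g y * wave L k \<phi> y)\<bar> \<le> C * (L / 2) ^ m * L ^ CARD('d)" .
    moreover have "0 \<le> B" using B[of 0] by simp
    ultimately show ?thesis using \<open>0 < L\<close> by (simp add: add_increasing2)
  qed
  then show ?thesis by (rule that)
qed

lemma summable_on_Ints_inverse_square: "(\<lambda>n::real. 1 / (1 + n\<^sup>2)) summable_on \<int>"
proof -
  have "summable (\<lambda>n. 1 / (1 + (real n)\<^sup>2))"
  proof (rule summable_comparison_test'[of "\<lambda>n. inverse (real n ^ 2)" 1])
    show "summable (\<lambda>n. inverse (real n ^ 2))" by (rule inverse_power_summable) simp
    show "norm (1 / (1 + (real n)\<^sup>2)) \<le> inverse (real n ^ 2)" if "1 \<le> n" for n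
      using that by (simp add: field_simps add_pos_nonneg)
  qed
  then have nat: "(\<lambda>n. 1 / (1 + (real n)\<^sup>2)) summable_on UNIV"
    by (subst summable_on_UNIV_nonneg_real_iff) auto
  have "(\<lambda>n::real. 1 / (1 + n\<^sup>2)) summable_on (range real)"
    using nat by (subst summable_on_reindex) (auto simp: o_def inj_on_def)
  moreover have "(\<lambda>n::real. 1 / (1 + n\<^sup>2)) summable_on (range (\<lambda>n. - real n))"
    using nat by (subst summable_on_reindex) (auto simp: o_def inj_on_def)
  ultimately have "(\<lambda>n::real. 1 / (1 + n\<^sup>2)) summable_on (range real \<union> range (\<lambda>n. - real n))"
    by (rule summable_on_union)
  moreover have "(\<int> :: real set) = range real \<union> range (\<lambda>n. - real n)"
  proof -
    have "real_of_int z \<in> range real \<union> range (\<lambda>n. - real n)" for z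
      by (cases z rule: int_cases2) (simp_all add: image_iff)
    then have "(\<int> :: real set) \<subseteq> range real \<union> range (\<lambda>n. - real n)"
      unfolding Ints_def by blast
    then show ?thesis by (intro equalityI) (simp_all add: image_subset_iff)
  qed
  ultimately show ?thesis by simp
qed

lemma summable_on_lattice_points:
  "(\<lambda>k::real ^ 'd. \<Prod>i\<in>UNIV. 1 / (1 + (k $ i)\<^sup>2)) summable_on lattice_points"
proof -
  have "Infinite_Set_Sum.abs_summable_on (\<lambda>g. \<Prod>i\<in>UNIV. 1 / (1 + (g i)\<^sup>2)) (PiE (UNIV :: 'd set) (\<lambda>_. \<int> :: real set))"
  proof (rule abs_summable_on_prod_PiE)
    show "countable (\<int> :: real set)" by (simp add: Ints_def)
    show "Infinite_Set_Sum.abs_summable_on (\<lambda>n::real. 1 / (1 + n\<^sup>2)) \<int>"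
      by (rule abs_summable_equivalent[THEN iffD1]) (use summable_on_Ints_inverse_square in simp)
  qed simp
  then have "(\<lambda>g. \<Prod>i\<in>UNIV. 1 / (1 + (g i)\<^sup>2)) summable_on (PiE (UNIV :: 'd set) (\<lambda>_. \<int> :: real set))"
    by (rule abs_summable_summable[OF abs_summable_equivalent[THEN iffD2]])
  moreover have "bij_betw (\<lambda>k :: real ^ 'd. \<lambda>i. k $ i) lattice_points (PiE UNIV (\<lambda>_. \<int>))"
    by (rule bij_betwI[where g = "\<lambda>g. \<chi> i. g i"]) (auto simp: lattice_points_def)
  ultimately show ?thesis
    using summable_on_reindex_bij_betw[of "\<lambda>k :: real ^ 'd. \<lambda>i. k $ i" lattice_points "PiE UNIV (\<lambda>_. \<int>)"
        "\<lambda>g. \<Prod>i\<in>UNIV. 1 / (1 + (g i)\<^sup>2)"] by simp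
qed

lemma countable_lattice_points: "countable (lattice_points :: (real ^ 'd) set)"
  and infinite_lattice_points: "infinite (lattice_points :: (real ^ 'd) set)"
proof -
  have eq: "(lattice_points :: (real ^ 'd) set) = (\<lambda>g. \<chi> i. g i) ` (PiE UNIV (\<lambda>_. \<int>))"
  proof (intro equalityI subsetI)
    fix k :: "real ^ 'd"
    assume "k \<in> lattice_points"
    then show "k \<in> (\<lambda>g. \<chi> i. g i) ` (PiE UNIV (\<lambda>_. \<int>))"
      by (intro image_eqI[of _ _ "\<lambda>i. k $ i"]) (auto simp: lattice_points_def)
  qed (auto simp: lattice_points_def)
  show "countable (lattice_points :: (real ^ 'd) set)"
    unfolding eq by (intro countable_image countable_PiE) (auto simp: Ints_def)
  have "inj (\<lambda>n::nat. \<chi> i::'d. real n)" by (auto simp: inj_on_def vec_eq_iff)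
  then have "infinite (range (\<lambda>n::nat. \<chi> i::'d. real n))" by (simp add: finite_image_iff)
  moreover have "range (\<lambda>n::nat. \<chi> i::'d. real n) \<subseteq> lattice_points" by (auto simp: lattice_points_def)
  ultimately show "infinite (lattice_points :: (real ^ 'd) set)" by (rule infinite_super[rotated])
qed

lemma fourier_coeff_cis:
  fixes f :: "real ^ 'd \<Rightarrow> real"
  assumes "continuous_on UNIV f"
  shows "Re (fourier_coeff L f k * cis \<theta>) = cell_integral L (\<lambda>y. f y * wave L k (- \<theta>) y) / L ^ CARD('d)"
proof -
  let ?F = "\<lambda>y. complex_of_real (f y) * cis (- (2 * pi / L) * (k \<bullet> y))"
  have F_cont: "continuous_on UNIV ?F"
    by (intro continuous_intros assms)
  have F_int: "set_integrable lborel (cell L) ?F"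
  proof (rule set_integrable_subset)
    show "set_integrable lborel (cbox 0 (\<chi> i. L)) ?F"
      unfolding set_integrable_def
      by (intro borel_integrable_compact continuous_on_subset[OF F_cont]) auto
  qed (auto simp: cell_subset)
  have "Re (fourier_coeff L f k * cis \<theta>) = Re (cis \<theta> * (LINT y:cell L|lborel. ?F y)) / L ^ CARD('d)"
    unfolding fourier_coeff_def cbox_integral_eq_cell[OF F_cont] by (simp add: mult_ac)
  also have "cis \<theta> * (LINT y:cell L|lborel. ?F y) = (LINT y:cell L|lborel. cis \<theta> * ?F y)"
    by (rule set_integral_mult_right[symmetric])
  also have "Re \<dots> = cell_integral L (\<lambda>y. Re (cis \<theta> * ?F y))"
  proof -
    have "integrable lborel (\<lambda>y. indicator (cell L) y *\<^sub>R (cis \<theta> * ?F y))"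
      using integrable_mult_right[OF F_int[unfolded set_integrable_def], of "cis \<theta>"] by (simp only: mult_scaleR_right)
    from integral_Re[OF this] show ?thesis
      unfolding set_lebesgue_integral_def by (simp only: scaleR_complex.sel real_scaleR_def)
  qed
  also have "(\<lambda>y. Re (cis \<theta> * ?F y)) = (\<lambda>y. f y * wave L k (- \<theta>) y)"
  proof
    fix y
    have "Re (cis \<theta> * ?F y) = f y * Re (cis \<theta> * cis (- (2 * pi / L) * (k \<bullet> y)))"
      by (simp add: algebra_simps)
    also have "\<dots> = f y * cos (- ((2 * pi / L) * (k \<bullet> y) + - \<theta>))"
      unfolding cis_mult by simp
    finally show "Re (cis \<theta> * ?F y) = f y * wave L k (- \<theta>) y"
      unfolding cos_minus wave_def .
  qed
  finally show ?thesis .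
qed

lemma norm_fourier_coeff:
  fixes f :: "real ^ 'd \<Rightarrow> real"
  assumes "continuous_on UNIV f"
  shows "norm (fourier_coeff L f k) = cell_integral L (\<lambda>y. f y * wave L k (Arg (fourier_coeff L f k)) y) / L ^ CARD('d)"
proof -
  let ?c = "fourier_coeff L f k"
  have "?c = complex_of_real (norm ?c) * cis (Arg ?c)"
    using rcis_cmod_Arg[of ?c] by (simp add: rcis_def)
  then have "?c * cis (- Arg ?c) = complex_of_real (norm ?c) * (cis (Arg ?c) * cis (- Arg ?c))"
    by (metis mult.assoc)
  then have "Re (?c * cis (- Arg ?c)) = norm ?c" by (simp add: cis_mult)
  then show ?thesis using fourier_coeff_cis[OF assms, of L k "- Arg ?c"] by simp
qed

lemma fourier_coeff_polar:
  "Re (fourier_coeff L f k * cis \<theta>) = norm (fourier_coeff L f k) * cos (\<theta> + Arg (fourier_coeff L f k))"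
proof -
  let ?c = "fourier_coeff L f k"
  have "?c * cis \<theta> = rcis (norm ?c) (Arg ?c) * rcis 1 \<theta>"
    by (simp only: rcis_cmod_Arg cis_rcis_eq)
  also have "\<dots> = rcis (norm ?c) (\<theta> + Arg ?c)"
    by (simp only: rcis_mult mult.right_neutral add.commute)
  finally show ?thesis by (simp only: Re_rcis)
qed

context
  fixes f :: "real ^ 'd \<Rightarrow> real" and L :: real
  assumes L: "0 < L" and Ck: "\<And>m. Ck_on m UNIV f" and per: "periodic L f"
begin

private lemma f_cont: "continuous_on UNIV f"
  using Ck[of 0] by simp

lemma fourier_coeff_summable:
  "(\<lambda>k. norm (fourier_coeff L f k) * (1 + (norm k)\<^sup>2)) summable_on lattice_points"
proof -
  let ?r = "\<lambda>k. norm (fourier_coeff L f k)"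
  define d where "d = CARD('d)"
  have decay: "\<exists>C. \<forall>k\<in>lattice_points. \<bar>k $ i\<bar> ^ m * ?r k \<le> C" for i m
  proof -
    obtain C where C: "\<And>k \<phi>. k \<in> lattice_points \<Longrightarrow> \<bar>k $ i\<bar> ^ m * \<bar>cell_integral L (\<lambda>y. f y * wave L k \<phi> y)\<bar> \<le> C"
      using wave_integral_decay[OF L Ck f_cont per, of i m] by metis
    have "\<bar>k $ i\<bar> ^ m * ?r k \<le> C / L ^ d" if "k \<in> lattice_points" for k
    proof -
      have "\<bar>k $ i\<bar> ^ m * ?r k \<le>
          \<bar>k $ i\<bar> ^ m * \<bar>cell_integral L (\<lambda>y. f y * wave L k (Arg (fourier_coeff L f k)) y)\<bar> / L ^ d"
        unfolding norm_fourier_coeff[OF f_cont, of L k] d_def times_divide_eq_right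
        using L by (intro divide_right_mono mult_left_mono) auto
      also have "\<dots> \<le> C / L ^ d" using C[OF that] L by (intro divide_right_mono) auto
      finally show ?thesis .
    qed
    then show ?thesis by blast
  qed
  have "\<exists>C. \<forall>i. \<forall>k\<in>lattice_points. \<bar>k $ i\<bar> ^ m * ?r k \<le> C i" for m
    using decay[of _ m] by (intro choice allI)
  then obtain C D where C: "\<And>i k. k \<in> lattice_points \<Longrightarrow> \<bar>k $ i\<bar> ^ (2 * (d + 1)) * ?r k \<le> C i"
    and D: "\<And>i k. k \<in> lattice_points \<Longrightarrow> \<bar>k $ i\<bar> ^ 0 * ?r k \<le> D i"
    by metis
  define B where "B = (\<Sum>i\<in>UNIV. max (C i) (D i))"
  have C0: "0 \<le> C i" "0 \<le> D i" for i
    using C[of 0 i] D[of 0 i] by (auto simp: lattice_points_def intro: order.trans[rotated])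
  have B: "C i \<le> B" "D i \<le> B" for i
    using member_le_sum[of i UNIV "\<lambda>i. max (C i) (D i)"] C0 by (auto simp: B_def max.coboundedI1)
  have key: "?r k * (1 + (norm k)\<^sup>2) ^ (d + 1) \<le> (1 + real d) ^ (d + 1) * B" if k: "k \<in> lattice_points" for k
  proof -
    obtain i where i: "\<And>j. \<bar>k $ j\<bar> \<le> \<bar>k $ i\<bar>"
    proof -
      have "finite (range (\<lambda>j. \<bar>k $ j\<bar>))" by simp
      then have "Max (range (\<lambda>j. \<bar>k $ j\<bar>)) \<in> range (\<lambda>j. \<bar>k $ j\<bar>)" by (rule Max_in) simp
      then obtain i where "Max (range (\<lambda>j. \<bar>k $ j\<bar>)) = \<bar>k $ i\<bar>" by blast
      then show ?thesis using Max_ge[of "range (\<lambda>j. \<bar>k $ j\<bar>)"] by (intro that[of i]) auto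
    qed
    define M where "M = max 1 ((k $ i)\<^sup>2)"
    have "(norm k)\<^sup>2 = (\<Sum>j\<in>UNIV. (k $ j)\<^sup>2)"
      unfolding power2_norm_eq_inner inner_vec_def by (simp add: power2_eq_square)
    also have "\<dots> \<le> (\<Sum>j\<in>(UNIV :: 'd set). (k $ i)\<^sup>2)"
      using i by (intro sum_mono) (simp add: abs_le_square_iff)
    also have "\<dots> \<le> real d * M" by (simp add: d_def M_def mult_left_mono)
    finally have "1 + (norm k)\<^sup>2 \<le> (1 + real d) * M" by (simp add: M_def algebra_simps)
    then have "(1 + (norm k)\<^sup>2) ^ (d + 1) \<le> ((1 + real d) * M) ^ (d + 1)"
      by (intro power_mono) auto
    then have "?r k * (1 + (norm k)\<^sup>2) ^ (d + 1) \<le> (1 + real d) ^ (d + 1) * (M ^ (d + 1) * ?r k)"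
      by (subst (asm) power_mult_distrib) (auto dest: mult_left_mono[of _ _ "?r k"] simp: mult_ac)
    also have "M ^ (d + 1) * ?r k \<le> B"
    proof (cases "(k $ i)\<^sup>2 \<le> 1")
      case True
      then show ?thesis using D[OF k, of i] B(2)[of i] by (simp add: M_def max_absorb1)
    next
      case False
      have "M ^ (d + 1) = \<bar>k $ i\<bar> ^ (2 * (d + 1))"
        using False unfolding M_def power_mult by (simp add: max_absorb2)
      then show ?thesis using C[OF k, of i] B(1)[of i] by simp
    qed
    finally show ?thesis by (simp add: mult_left_mono)
  qed
  have "(\<lambda>k. (1 + real d) ^ (d + 1) * B * (\<Prod>i\<in>UNIV. 1 / (1 + (k $ i)\<^sup>2))) summable_on (lattice_points :: (real ^ 'd) set)"
    by (intro summable_on_cmult_right summable_on_lattice_points)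
  then show ?thesis
  proof (rule summable_on_comparison_test)
    fix k :: "real ^ 'd" assume k: "k \<in> lattice_points"
    have "(\<Prod>i\<in>UNIV. 1 + (k $ i)\<^sup>2) \<le> (\<Prod>i\<in>(UNIV :: 'd set). 1 + (norm k)\<^sup>2)"
      using power_mono[OF component_le_norm_cart abs_ge_zero, of k _ 2] by (intro prod_mono) auto
    then have P: "(\<Prod>i\<in>UNIV. 1 + (k $ i)\<^sup>2) \<le> (1 + (norm k)\<^sup>2) ^ d" by (simp add: d_def)
    have P0: "0 < (\<Prod>i\<in>UNIV. 1 + (k $ i)\<^sup>2)" by (intro prod_pos) (auto simp: add_pos_nonneg)
    have "?r k * (1 + (norm k)\<^sup>2) * (\<Prod>i\<in>UNIV. 1 + (k $ i)\<^sup>2) \<le> ?r k * (1 + (norm k)\<^sup>2) * (1 + (norm k)\<^sup>2) ^ d"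
      by (intro mult_left_mono P) auto
    also have "\<dots> \<le> (1 + real d) ^ (d + 1) * B" using key[OF k] by (simp add: mult_ac)
    finally show "?r k * (1 + (norm k)\<^sup>2) \<le> (1 + real d) ^ (d + 1) * B * (\<Prod>i\<in>UNIV. 1 / (1 + (k $ i)\<^sup>2))"
      using P0 by (simp add: prod_dividef pos_le_divide_eq)
  qed auto
qed

definition freq :: "nat \<Rightarrow> real ^ 'd" where
  "freq = from_nat_into lattice_points"

definition amp :: "nat \<Rightarrow> real" where
  "amp j = norm (fourier_coeff L f (freq j))"

definition phase :: "nat \<Rightarrow> real" where
  "phase j = Arg (fourier_coeff L f (freq j))"

private lemma freq_bij: "bij_betw freq UNIV lattice_points"
  unfolding freq_def by (rule bij_betw_from_nat_into[OF countable_lattice_points infinite_lattice_points])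

private lemma freq_lattice: "freq j \<in> lattice_points"
  using freq_bij by (auto simp: bij_betw_def)

lemma amp_nonneg: "0 \<le> amp j"
  by (simp add: amp_def)

private lemma amp_summable_square: "summable (\<lambda>j. amp j * (1 + (norm (freq j))\<^sup>2))"
proof -
  have "(\<lambda>j. amp j * (1 + (norm (freq j))\<^sup>2)) summable_on UNIV"
    using summable_on_reindex_bij_betw[OF freq_bij, of "\<lambda>k. norm (fourier_coeff L f k) * (1 + (norm k)\<^sup>2)"]
      fourier_coeff_summable by (simp add: amp_def)
  then show ?thesis by (rule summable_on_imp_summable)
qed

lemma amp_summable: "summable amp"
proof (rule summable_comparison_test'[OF amp_summable_square, of 0])
  show "norm (amp j) \<le> amp j * (1 + (norm (freq j))\<^sup>2)" for j
    using mult_left_mono[of 1 "1 + (norm (freq j))\<^sup>2", OF _ amp_nonneg[of j]] by (simp add: amp_nonneg)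
qed

lemma amp_powr_summable:
  assumes "0 < \<alpha>" "\<alpha> < 1"
  shows "summable (\<lambda>j. amp j * norm ((2 * pi / L) *\<^sub>R freq j) powr (2 * \<alpha>))"
proof (rule summable_comparison_test'[OF summable_mult[OF amp_summable_square, of "1 + (2 * pi / L)\<^sup>2"], of 0])
  fix j
  have "norm ((2 * pi / L) *\<^sub>R freq j) powr (2 * \<alpha>) \<le> 1 + (norm ((2 * pi / L) *\<^sub>R freq j))\<^sup>2"
    using powr_le_one_plus_square[OF assms, of "norm ((2 * pi / L) *\<^sub>R freq j)"] by simp
  also have "\<dots> = 1 + (2 * pi / L)\<^sup>2 * (norm (freq j))\<^sup>2"
    by (simp add: power_mult_distrib power_divide)
  also have "\<dots> \<le> (1 + (2 * pi / L)\<^sup>2) * (1 + (norm (freq j))\<^sup>2)"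
    by (simp add: algebra_simps)
  finally have "amp j * norm ((2 * pi / L) *\<^sub>R freq j) powr (2 * \<alpha>) \<le> amp j * ((1 + (2 * pi / L)\<^sup>2) * (1 + (norm (freq j))\<^sup>2))"
    by (rule mult_left_mono[OF _ amp_nonneg])
  also have "\<dots> = (1 + (2 * pi / L)\<^sup>2) * (amp j * (1 + (norm (freq j))\<^sup>2))"
    by (rule mult.left_commute)
  finally show "norm (amp j * norm ((2 * pi / L) *\<^sub>R freq j) powr (2 * \<alpha>)) \<le> (1 + (2 * pi / L)\<^sup>2) * (amp j * (1 + (norm (freq j))\<^sup>2))"
    by (simp only: real_norm_def abs_of_nonneg mult_nonneg_nonneg amp_nonneg powr_ge_zero)
qed

private lemma series_summable: "summable (\<lambda>j. amp j * wave L (freq j) (phase j) x)"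
  by (rule summable_comparison_test'[OF amp_summable, of 0])
     (auto simp: abs_mult amp_nonneg abs_wave_le_1 intro!: mult_left_le)

private lemma series_continuous: "continuous_on UNIV (\<lambda>x. \<Sum>j. amp j * wave L (freq j) (phase j) x)"
proof (rule uniform_limit_theorem)
  show "uniform_limit UNIV (\<lambda>n x. \<Sum>j<n. amp j * wave L (freq j) (phase j) x)
      (\<lambda>x. \<Sum>j. amp j * wave L (freq j) (phase j) x) sequentially"
    by (rule Weierstrass_m_test[OF _ amp_summable])
       (auto simp: abs_mult amp_nonneg abs_wave_le_1 intro!: mult_left_le)
qed (auto intro!: always_eventually continuous_intros)

private lemma series_wave_integral:
  assumes l: "l \<in> lattice_points"
  shows "cell_integral L (\<lambda>y. (\<Sum>j. amp j * wave L (freq j) (phase j) y) * wave L l \<psi> y) =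
    cell_integral L (\<lambda>y. f y * wave L l \<psi> y)"
proof -
  let ?t = "\<lambda>j y. indicator (cell L) y * (amp j * (wave L (freq j) (phase j) y * wave L l \<psi> y))"
  have int: "integrable lborel (?t j)" for j
  proof -
    have "set_integrable lborel (cell L) (\<lambda>y. amp j * (wave L (freq j) (phase j) y * wave L l \<psi> y))"
      by (intro set_integrable_cell continuous_intros)
    then show ?thesis by (simp add: set_integrable_def)
  qed
  have t_le: "\<bar>?t j y\<bar> \<le> amp j * indicator (cell L) y" for j y
    by (auto simp: abs_mult amp_nonneg abs_wave_le_1 mult_le_one mult_left_le split: split_indicator)
  have cell_int: "integrable lborel (indicator (cell L) :: real ^ 'd \<Rightarrow> real)"
    using set_integrable_cell[of "\<lambda>_. 1" L] by (simp add: set_integrable_def)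
  have cell_vol: "(LINT y|lborel. indicator (cell L :: (real ^ 'd) set) y) = L ^ CARD('d)"
    using cell_integral_const[OF L, of 1, where 'd = 'd] by (simp add: set_lebesgue_integral_def)
  have "cell_integral L (\<lambda>y. (\<Sum>j. amp j * wave L (freq j) (phase j) y) * wave L l \<psi> y) = (LINT y|lborel. (\<Sum>j. ?t j y))"
    unfolding set_lebesgue_integral_def
  proof (intro Bochner_Integration.integral_cong refl)
    fix y
    have "(\<Sum>j. ?t j y) = (\<Sum>j. (indicator (cell L) y * wave L l \<psi> y) * (amp j * wave L (freq j) (phase j) y))"
      by (simp add: mult_ac)
    also have "\<dots> = (indicator (cell L) y * wave L l \<psi> y) * (\<Sum>j. amp j * wave L (freq j) (phase j) y)"
      by (rule suminf_mult[OF series_summable])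
    finally show "indicator (cell L) y *\<^sub>R ((\<Sum>j. amp j * wave L (freq j) (phase j) y) * wave L l \<psi> y) = (\<Sum>j. ?t j y)"
      by (simp add: mult_ac)
  qed
  also have "\<dots> = (\<Sum>j. LINT y|lborel. ?t j y)"
  proof (rule integral_suminf[OF int])
    show "AE y in lborel. summable (\<lambda>j. norm (?t j y))"
    proof (rule AE_I2)
      fix y
      show "summable (\<lambda>j. norm (?t j y))"
        by (rule summable_comparison_test'[OF summable_mult2[OF amp_summable, of "indicator (cell L) y"], of 0])
           (use t_le in simp)
    qed
    show "summable (\<lambda>j. LINT y|lborel. norm (?t j y))"
    proof (rule summable_comparison_test'[OF summable_mult2[OF amp_summable, of "L ^ CARD('d)"], of 0])
      fix j
      have "(LINT y|lborel. norm (?t j y)) \<le> (LINT y|lborel. amp j * indicator (cell L) (y :: real ^ 'd))"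
        by (rule integral_mono) (use int cell_int t_le in auto)
      also have "\<dots> = amp j * L ^ CARD('d)" using cell_vol by simp
      finally show "norm (LINT y|lborel. norm (?t j y)) \<le> amp j * L ^ CARD('d)"
        by (simp add: integral_nonneg_AE)
    qed
  qed
  also have "\<dots> = (\<Sum>j. L ^ CARD('d) / 2 * ((if freq j = - l then Re (fourier_coeff L f (- l) * cis \<psi>) else 0)
      + (if freq j = l then Re (fourier_coeff L f l * cis (- \<psi>)) else 0)))"
  proof (rule suminf_cong)
    fix j
    have "(LINT y|lborel. ?t j y) = amp j * cell_integral L (\<lambda>y. wave L (freq j) (phase j) y * wave L l \<psi> y)"
      unfolding set_lebesgue_integral_def by (subst integral_mult_right_zero[symmetric]) (simp add: mult_ac)
    also have "\<dots> = L ^ CARD('d) / 2 * ((if freq j = - l then amp j * cos (phase j + \<psi>) else 0)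
        + (if freq j = l then amp j * cos (phase j - \<psi>) else 0))"
      unfolding wave_product_integral[OF freq_lattice l L] by (simp add: algebra_simps)
    also have "\<dots> = L ^ CARD('d) / 2 * ((if freq j = - l then Re (fourier_coeff L f (freq j) * cis \<psi>) else 0)
        + (if freq j = l then Re (fourier_coeff L f (freq j) * cis (- \<psi>)) else 0))"
      unfolding fourier_coeff_polar amp_def phase_def by (simp add: add.commute)
    finally show "(LINT y|lborel. ?t j y) = L ^ CARD('d) / 2 * ((if freq j = - l then Re (fourier_coeff L f (- l) * cis \<psi>) else 0)
      + (if freq j = l then Re (fourier_coeff L f l * cis (- \<psi>)) else 0))"
      by (simp only: cong: if_cong)
  qed
  also have "\<dots> = L ^ CARD('d) / 2 * (Re (fourier_coeff L f (- l) * cis \<psi>) + Re (fourier_coeff L f l * cis (- \<psi>)))"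
  proof -
    have single: "(\<lambda>j. if freq j = k then A else 0) sums A" if "k \<in> lattice_points" for k and A :: real
    proof -
      obtain j0 where "freq j0 = k" using freq_bij \<open>k \<in> lattice_points\<close> unfolding bij_betw_def by (metis imageE)
      then have "freq j = k \<longleftrightarrow> j = j0" for j using freq_bij by (auto simp: bij_betw_def inj_on_def)
      then show ?thesis using sums_single[of j0 "\<lambda>_. A"] by simp
    qed
    show ?thesis
      by (rule sums_unique[symmetric]) (intro sums_mult sums_add single l lattice_points_minus)
  qed
  also have "\<dots> = cell_integral L (\<lambda>y. f y * wave L l \<psi> y)"
    unfolding fourier_coeff_cis[OF f_cont] wave_minus using L by simp
  finally show ?thesis .
qed

lemma fourier_series: "f x = (\<Sum>j. amp j * cos (((2 * pi / L) *\<^sub>R freq j) \<bullet> x + phase j))"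
proof -
  let ?S = "\<lambda>x. \<Sum>j. amp j * wave L (freq j) (phase j) x"
  have "f x - ?S x = 0"
  proof (rule orthogonal_imp_zero[OF L])
    show "continuous_on UNIV (\<lambda>x. f x - ?S x)"
      by (intro continuous_intros f_cont series_continuous)
    show "periodic L (\<lambda>x. f x - ?S x)"
      using per wave_periodic[OF freq_lattice L] by (simp add: periodic_def)
    fix k :: "real ^ 'd" and \<phi>
    assume k: "k \<in> lattice_points"
    have "cell_integral L (\<lambda>y. (f y - ?S y) * wave L k \<phi> y) =
        cell_integral L (\<lambda>y. 1 * (f y * wave L k \<phi> y) + (- 1) * (?S y * wave L k \<phi> y))"
      by (simp add: left_diff_distrib)
    also have "\<dots> = 1 * cell_integral L (\<lambda>y. f y * wave L k \<phi> y) + (- 1) * cell_integral L (\<lambda>y. ?S y * wave L k \<phi> y)"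
      by (rule cell_integral_linear) (intro continuous_intros f_cont series_continuous)+
    finally show "cell_integral L (\<lambda>y. (f y - ?S y) * wave L k \<phi> y) = 0"
      by (simp add: series_wave_integral[OF k])
  qed
  then show ?thesis by (simp add: wave_def)
qed

lemma frac_laplacian_series:
  assumes "0 < \<alpha>" "\<alpha> < 1"
  shows "frac_laplacian L \<alpha> f x =
    (\<Sum>j. amp j * norm ((2 * pi / L) *\<^sub>R freq j) powr (2 * \<alpha>) * cos (((2 * pi / L) *\<^sub>R freq j) \<bullet> x + phase j))"
proof -
  let ?F = "\<lambda>k. complex_of_real ((2 * pi * norm k / L) powr (2 * \<alpha>)) * fourier_coeff L f k * cis ((2 * pi / L) * (k \<bullet> x))"
  have nrm: "norm ((2 * pi / L) *\<^sub>R freq j) = 2 * pi * norm (freq j) / L" for j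
    using L by simp
  have "summable (\<lambda>j. norm (?F (freq j)))"
    using amp_powr_summable[OF assms] unfolding nrm by (simp add: norm_mult amp_def mult_ac)
  then have "(\<lambda>j. ?F (freq j)) summable_on UNIV" by (rule norm_summable_imp_summable_on)
  then have "?F summable_on lattice_points"
    using summable_on_reindex_bij_betw[OF freq_bij, of ?F] by simp
  then have "(?F has_sum (\<Sum>\<^sub>\<infinity>k\<in>lattice_points. ?F k)) lattice_points" by (rule has_sum_infsum)
  then have "((\<lambda>j. ?F (freq j)) has_sum (\<Sum>\<^sub>\<infinity>k\<in>lattice_points. ?F k)) UNIV"
    using has_sum_reindex_bij_betw[OF freq_bij, of ?F] by simp
  from has_sum_imp_sums[OF has_sum_Re[OF this]]
  have "frac_laplacian L \<alpha> f x = (\<Sum>j. Re (?F (freq j)))"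
    by (simp add: sums_iff frac_laplacian_def lattice_points_def)
  also have "\<dots> = (\<Sum>j. amp j * norm ((2 * pi / L) *\<^sub>R freq j) powr (2 * \<alpha>) * cos (((2 * pi / L) *\<^sub>R freq j) \<bullet> x + phase j))"
  proof (rule suminf_cong)
    fix j
    have "Re (?F (freq j)) = (2 * pi * norm (freq j) / L) powr (2 * \<alpha>) * Re (fourier_coeff L f (freq j) * cis ((2 * pi / L) * (freq j \<bullet> x)))"
      by (simp add: algebra_simps)
    then show "Re (?F (freq j)) = amp j * norm ((2 * pi / L) *\<^sub>R freq j) powr (2 * \<alpha>) * cos (((2 * pi / L) *\<^sub>R freq j) \<bullet> x + phase j)"
      unfolding fourier_coeff_polar nrm by (simp add: amp_def phase_def mult_ac)
  qed
  finally show ?thesis .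
qed

end

section \<open>The dissipation estimate\<close>

lemma Ck_on_slice:
  fixes F :: "'a::euclidean_space \<times> real \<Rightarrow> real"
  assumes "Ck_on k (UNIV \<times> T) F" "t \<in> T"
  shows "Ck_on k UNIV (\<lambda>x. F (x, t))"
  using assms(1)
proof (induction k arbitrary: F)
  case 0
  then show ?case
    using assms(2) by (auto intro!: continuous_on_compose2[of "UNIV \<times> T" F] continuous_intros)
next
  case (Suc k)
  then obtain F' where d: "\<forall>z\<in>UNIV \<times> T. (F has_derivative (\<lambda>h. \<Sum>b\<in>Basis. F' b z * (h \<bullet> b))) (at z within UNIV \<times> T)"
    and F': "\<forall>b\<in>Basis. Ck_on k (UNIV \<times> T) (F' b)"
    unfolding Ck_on.simps by blast
  have "((\<lambda>x. F (x, t)) has_derivative (\<lambda>h. \<Sum>b\<in>Basis. F' (b, 0) (x, t) * (h \<bullet> b))) (at x)" for x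
  proof -
    have "((\<lambda>x. F (x, t)) has_derivative (\<lambda>h. \<Sum>b\<in>Basis. F' b (x, t) * ((h, 0) \<bullet> b))) (at x)"
    proof (rule has_derivative_in_compose2[of "UNIV \<times> T" F "\<lambda>z h. \<Sum>b\<in>Basis. F' b z * (h \<bullet> b)" "\<lambda>x. (x, t)" UNIV x "\<lambda>h. (h, 0)"])
      show "((\<lambda>x. (x, t)) has_derivative (\<lambda>h. (h, 0))) (at x)"
        by (intro has_derivative_Pair has_derivative_ident has_derivative_const)
    qed (use d assms(2) in auto)
    moreover have "(\<Sum>b\<in>Basis. F' b (x, t) * ((h, 0) \<bullet> b)) = (\<Sum>b\<in>Basis. F' (b, 0) (x, t) * (h \<bullet> b))" for h
      unfolding Basis_prod_def
      by (subst sum.union_disjoint) (auto simp: sum.reindex inj_on_def nonzero_Basis)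
    ultimately show ?thesis by simp
  qed
  moreover have "Ck_on k UNIV (\<lambda>x. F' (b, 0) (x, t))" if "b \<in> Basis" for b
    by (rule Suc.IH[OF bspec[OF F']]) (use that in \<open>simp add: Basis_prod_def\<close>)
  ultimately show ?case
    by (simp, intro exI[of _ "\<lambda>b x. F' (b, 0) (x, t)"]) simp
qed

lemma dissipation_eq:
  fixes w :: "real \<Rightarrow> real"
  assumes moc: "modulus_of_continuity w" and "0 < \<xi>" and "0 < c"
  shows "dissipation c \<alpha> w \<xi> = - enn2ereal (ennreal c * (\<integral>\<^sup>+s. ennreal (second_gap w \<xi> s / 2) \<partial>levy_measure \<alpha>))"
proof -
  note [measurable] = borel_measurable_second_gap[OF moc]
  let ?g = "\<lambda>s. ennreal (second_gap w \<xi> s) * ennreal (\<bar>s\<bar> powr (- 1 - 2 * \<alpha>))"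
  let ?h1 = "\<lambda>\<eta>. (w (\<xi> + 2 * \<eta>) + w (\<xi> - 2 * \<eta>) - 2 * w \<xi>) / \<eta> powr (1 + 2 * \<alpha>)"
  let ?h2 = "\<lambda>\<eta>. (w (2 * \<eta> + \<xi>) - w (2 * \<eta> - \<xi>) - 2 * w \<xi>) / \<eta> powr (1 + 2 * \<alpha>)"
  have gap0: "0 \<le> second_gap w \<xi> s" for s
    using second_gap_nonneg[OF moc \<open>0 < \<xi>\<close>] .
  have pw: "a / \<eta> powr (1 + 2 * \<alpha>) = a * \<eta> powr (- 1 - 2 * \<alpha>)" for a \<eta> :: real
    using powr_minus_divide[of \<eta> "1 + 2 * \<alpha>"] by (simp add: algebra_simps)
  have h1: "ennreal (- ?h1 \<eta>) = ?g \<eta>" if "0 \<le> \<eta>" "\<eta> \<le> \<xi> / 2" for \<eta>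
  proof -
    have "- ?h1 \<eta> = second_gap w \<xi> \<eta> * \<bar>\<eta>\<bar> powr (- 1 - 2 * \<alpha>)"
      unfolding pw using that \<open>0 < \<xi>\<close> by (simp add: second_gap_def odd_ext_nonneg_arg[OF moc] algebra_simps)
    then show ?thesis using gap0 by (simp add: ennreal_mult)
  qed
  have h2: "ennreal (- ?h2 \<eta>) = ?g \<eta>" if "\<xi> / 2 \<le> \<eta>" for \<eta>
  proof -
    have "- ?h2 \<eta> = second_gap w \<xi> \<eta> * \<bar>\<eta>\<bar> powr (- 1 - 2 * \<alpha>)"
      unfolding pw using that \<open>0 < \<xi>\<close> odd_ext_minus[of w "\<xi> - 2 * \<eta>"]
      by (simp add: second_gap_def odd_ext_nonneg_arg[OF moc] algebra_simps)
    then show ?thesis using gap0 by (simp add: ennreal_mult)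
  qed
  have "(\<integral>\<^sup>+\<eta>\<in>{0..\<xi> / 2}. ennreal (- ?h1 \<eta>) \<partial>lborel) + (\<integral>\<^sup>+\<eta>\<in>{\<xi> / 2..}. ennreal (- ?h2 \<eta>) \<partial>lborel)
      = (\<integral>\<^sup>+\<eta>\<in>{0..\<xi> / 2}. ?g \<eta> \<partial>lborel) + (\<integral>\<^sup>+\<eta>\<in>{\<xi> / 2..}. ?g \<eta> \<partial>lborel)"
    by (intro arg_cong2[where f = "(+)"] nn_integral_cong) (auto simp: h1 h2 split: split_indicator)
  also have "\<dots> = (\<integral>\<^sup>+\<eta>. ?g \<eta> * indicator {0..\<xi> / 2} \<eta> + ?g \<eta> * indicator {\<xi> / 2..} \<eta> \<partial>lborel)"
    by (rule nn_integral_add[symmetric]) measurable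
  also have "\<dots> = (\<integral>\<^sup>+\<eta>. ?g \<eta> * indicator {0<..} \<eta> \<partial>lborel)"
  proof (rule nn_integral_cong_AE)
    have "AE \<eta> in lborel. \<eta> \<noteq> (0::real)" "AE \<eta> in lborel. \<eta> \<noteq> \<xi> / 2"
      by (rule AE_lborel_singleton)+
    then show "AE \<eta> in lborel. ?g \<eta> * indicator {0..\<xi> / 2} \<eta> + ?g \<eta> * indicator {\<xi> / 2..} \<eta> = ?g \<eta> * indicator {0<..} \<eta>"
      by eventually_elim (use \<open>0 < \<xi>\<close> in \<open>auto split: split_indicator\<close>)
  qed
  finally have half: "(\<integral>\<^sup>+\<eta>\<in>{0..\<xi> / 2}. ennreal (- ?h1 \<eta>) \<partial>lborel) + (\<integral>\<^sup>+\<eta>\<in>{\<xi> / 2..}. ennreal (- ?h2 \<eta>) \<partial>lborel)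
      = (\<integral>\<^sup>+\<eta>. ?g \<eta> * indicator {0<..} \<eta> \<partial>lborel)" .
  have "(\<integral>\<^sup>+\<eta>. ?g \<eta> * indicator {..<0} \<eta> \<partial>lborel) = (\<integral>\<^sup>+\<eta>. ?g (- \<eta>) * indicator {..<0} (- \<eta>) \<partial>lborel)"
    by (subst nn_integral_real_affine[where c = "-1" and t = 0]) auto
  also have "\<dots> = (\<integral>\<^sup>+\<eta>. ?g \<eta> * indicator {0<..} \<eta> \<partial>lborel)"
    by (intro nn_integral_cong) (auto simp: second_gap_minus split: split_indicator)
  finally have refl: "(\<integral>\<^sup>+\<eta>. ?g \<eta> * indicator {..<0} \<eta> \<partial>lborel) = (\<integral>\<^sup>+\<eta>. ?g \<eta> * indicator {0<..} \<eta> \<partial>lborel)" .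
  have "(\<integral>\<^sup>+s. ennreal (second_gap w \<xi> s / 2) \<partial>levy_measure \<alpha>) = (\<integral>\<^sup>+\<eta>. ennreal (1/2) * ?g \<eta> \<partial>lborel)"
  proof (subst nn_integral_levy_measure)
    have "ennreal b * ennreal (a / 2) = ennreal (1/2) * (ennreal a * ennreal b)" if "0 \<le> a" "0 \<le> b" for a b
    proof -
      have "ennreal (1/2) * (ennreal a * ennreal b) = ennreal (1/2 * (a * b))"
        using that by (subst ennreal_mult', simp, subst ennreal_mult') (rule refl | simp)+
      also have "\<dots> = ennreal (b * (a / 2))" by (simp add: mult.commute)
      also have "\<dots> = ennreal b * ennreal (a / 2)" using that(2) by (rule ennreal_mult')
      finally show ?thesis ..
    qed
    then show "(\<integral>\<^sup>+s. ennreal (\<bar>s\<bar> powr (- 1 - 2 * \<alpha>)) * ennreal (second_gap w \<xi> s / 2) \<partial>lborel) = (\<integral>\<^sup>+\<eta>. ennreal (1/2) * ?g \<eta> \<partial>lborel)"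
      using gap0 by (intro nn_integral_cong) (simp only: powr_ge_zero)
  qed measurable
  also have "\<dots> = ennreal (1/2) * (\<integral>\<^sup>+\<eta>. ?g \<eta> \<partial>lborel)"
    by (rule nn_integral_cmult) measurable
  also have "(\<integral>\<^sup>+\<eta>. ?g \<eta> \<partial>lborel) = (\<integral>\<^sup>+\<eta>. ?g \<eta> * indicator {..<0} \<eta> + ?g \<eta> * indicator {0<..} \<eta> \<partial>lborel)"
    by (intro nn_integral_cong) (auto split: split_indicator)
  also have "\<dots> = (\<integral>\<^sup>+\<eta>. ?g \<eta> * indicator {..<0} \<eta> \<partial>lborel) + (\<integral>\<^sup>+\<eta>. ?g \<eta> * indicator {0<..} \<eta> \<partial>lborel)"
    by (rule nn_integral_add) measurable
  also have "ennreal (1/2) * \<dots> = (\<integral>\<^sup>+\<eta>. ?g \<eta> * indicator {0<..} \<eta> \<partial>lborel)"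
  proof -
    have "ennreal (1/2) * (X + X) = X" for X
    proof -
      have "ennreal (1/2) * (X + X) = (ennreal (1/2) + ennreal (1/2)) * X"
        by (simp add: distrib_left distrib_right)
      also have "ennreal (1/2) + ennreal (1/2) = 1"
        by (subst ennreal_plus[symmetric]) auto
      finally show ?thesis by simp
    qed
    then show ?thesis unfolding refl .
  qed
  finally have full: "(\<integral>\<^sup>+s. ennreal (second_gap w \<xi> s / 2) \<partial>levy_measure \<alpha>) = (\<integral>\<^sup>+\<eta>. ?g \<eta> * indicator {0<..} \<eta> \<partial>lborel)" .
  have add: "- enn2ereal X + - enn2ereal Y = - enn2ereal (X + Y)" for X Y
    by (cases X; cases Y) (auto simp: plus_ennreal.rep_eq)
  have mult: "ereal c * - enn2ereal X = - enn2ereal (ennreal c * X)" for X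
    using \<open>0 < c\<close> by (simp add: times_ennreal.rep_eq enn2ereal_ennreal)
  show ?thesis
    unfolding dissipation_def nonpos_integral_def add mult half full ..
qed

theorem lemma2p5:
  fixes \<theta> :: "real ^ 'd \<Rightarrow> real \<Rightarrow> real"
    and U :: "(real ^ 'd \<Rightarrow> real \<Rightarrow> real) \<Rightarrow> real ^ 'd \<Rightarrow> real \<Rightarrow> real ^ 'd"
    and \<omega> :: "real \<Rightarrow> real \<Rightarrow> real"
    and \<alpha> c L t\<^sub>1 \<xi> :: real
    and x y :: "real ^ 'd"
  assumes "0 < \<alpha>" and "\<alpha> < 1"
    and "kernel_constant \<alpha> c"
    and "0 < L"
    and "smooth_periodic_solution L \<alpha> U \<theta>"
    and "continuous_on ({0..} \<times> {0..}) (\<lambda>(s, t). \<omega> s t)"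
    and "\<And>s. 0 \<le> s \<Longrightarrow> piecewise_C1_on {0..} (\<lambda>t. \<omega> s t)"
    and "\<And>t. 0 \<le> t \<Longrightarrow> modulus_of_continuity (\<lambda>s. \<omega> s t)"
    and "\<And>t. 0 \<le> t \<Longrightarrow> second_deriv_minus_infinity_at_0 (\<lambda>s. \<omega> s t)"
    and "0 < t\<^sub>1"
    and "x \<noteq> y"
    and "\<xi> = norm (x - y)"
    and "\<And>t. 0 \<le> t \<Longrightarrow> t < t\<^sub>1 \<Longrightarrow> obeys (\<lambda>z. \<theta> z t) (\<lambda>s. \<omega> s t)"
    and "\<theta> x t\<^sub>1 - \<theta> y t\<^sub>1 = \<omega> \<xi> t\<^sub>1"
  shows "ereal (- frac_laplacian L \<alpha> (\<lambda>z. \<theta> z t\<^sub>1) x + frac_laplacian L \<alpha> (\<lambda>z. \<theta> z t\<^sub>1) y)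
           \<le> dissipation c \<alpha> (\<lambda>s. \<omega> s t\<^sub>1) \<xi>"
proof -
  let ?f = "\<lambda>z. \<theta> z t\<^sub>1" and ?w = "\<lambda>s. \<omega> s t\<^sub>1"
  have "0 < \<xi>" using assms by simp
  have "0 < c" using assms(3) by (simp add: kernel_constant_def)
  have moc: "modulus_of_continuity ?w" using assms by simp
  have smooth: "Ck_on m (UNIV \<times> {0..}) (\<lambda>(x, t). \<theta> x t)" for m
    using assms(5) by (simp add: smooth_periodic_solution_def smooth_on_def)
  have Ck: "Ck_on m UNIV ?f" for m
    using Ck_on_slice[OF smooth, of t\<^sub>1] \<open>0 < t\<^sub>1\<close> by simp
  from Ck[of 0] have cont: "continuous_on UNIV ?f" by simp
  have per: "periodic L ?f" using assms(5,10) by (simp add: smooth_periodic_solution_def)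
  have mod: "\<bar>?f a - ?f b\<bar> \<le> ?w (norm (a - b))" for a b
  proof (cases "a = b")
    case True
    then show ?thesis using moc by (simp add: modulus_of_continuity_def)
  next
    case False
    have \<theta>_lim: "((\<lambda>t. \<theta> z t) \<longlongrightarrow> \<theta> z t\<^sub>1) (at t\<^sub>1 within {0..<t\<^sub>1})" for z
    proof -
      have "continuous_on {0..} (\<lambda>t. (\<lambda>(x, t). \<theta> x t) (z, t))"
        by (rule continuous_on_compose2[OF smooth[of 0, unfolded Ck_on.simps]]) (auto intro!: continuous_intros)
      then have "((\<lambda>t. \<theta> z t) \<longlongrightarrow> \<theta> z t\<^sub>1) (at t\<^sub>1 within {0..})"
        using \<open>0 < t\<^sub>1\<close> by (simp add: continuous_on_def)
      then show ?thesis by (rule tendsto_within_subset) auto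
    qed
    have \<omega>_lim: "((\<lambda>t. \<omega> (norm (a - b)) t) \<longlongrightarrow> \<omega> (norm (a - b)) t\<^sub>1) (at t\<^sub>1 within {0..<t\<^sub>1})"
    proof -
      have "continuous_on {0..} (\<lambda>t. (\<lambda>(s, t). \<omega> s t) (norm (a - b), t))"
        by (rule continuous_on_compose2[OF assms(6)]) (auto intro!: continuous_intros)
      then have "((\<lambda>t. \<omega> (norm (a - b)) t) \<longlongrightarrow> \<omega> (norm (a - b)) t\<^sub>1) (at t\<^sub>1 within {0..})"
        using \<open>0 < t\<^sub>1\<close> by (simp add: continuous_on_def)
      then show ?thesis by (rule tendsto_within_subset) auto
    qed
    have "at t\<^sub>1 within {0..<t\<^sub>1} \<noteq> bot"
      using \<open>0 < t\<^sub>1\<close> by (simp add: at_within_eq_bot_iff)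
    moreover have "((\<lambda>t. \<bar>\<theta> a t - \<theta> b t\<bar>) \<longlongrightarrow> \<bar>\<theta> a t\<^sub>1 - \<theta> b t\<^sub>1\<bar>) (at t\<^sub>1 within {0..<t\<^sub>1})"
      by (intro tendsto_intros \<theta>_lim)
    moreover have "\<forall>\<^sub>F t in at t\<^sub>1 within {0..<t\<^sub>1}. \<bar>\<theta> a t - \<theta> b t\<bar> \<le> \<omega> (norm (a - b)) t"
      using assms(13) False unfolding obeys_def eventually_at_filter
      by (intro always_eventually) (auto intro: less_imp_le)
    ultimately show ?thesis using tendsto_le[OF _ \<omega>_lim] by blast
  qed
  define \<kappa> where "\<kappa> j = (2 * pi / L) *\<^sub>R freq j" for j
  let ?I = "\<integral>\<^sup>+s. ennreal (second_gap ?w \<xi> s / 2) \<partial>levy_measure \<alpha>"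
  let ?D = "frac_laplacian L \<alpha> ?f x - frac_laplacian L \<alpha> ?f y"
  note kc = kernel_constant_le[OF assms(1,3)]
  have "gauss_gap \<alpha> < \<infinity>"
  proof (rule ccontr)
    assume "\<not> gauss_gap \<alpha> < \<infinity>"
    then have "ennreal c * gauss_gap \<alpha> = \<infinity>"
      using \<open>0 < c\<close> by (simp add: ennreal_mult_top less_top[symmetric] ennreal_mult_eq_top_iff)
    then show False using kc gauss_moment_finite[OF assms(1,2)] by simp
  qed
  have touch: "?f x - ?f y = ?w (norm (x - y))" using assms(12,14) by simp
  note lower = frac_laplacian_series_lower[OF amp_nonneg[OF assms(4) Ck per] amp_summable[OF assms(4) Ck per]
      fourier_series[OF assms(4) Ck per] moc \<open>x \<noteq> y\<close> cont mod touch \<open>gauss_gap \<alpha> < \<infinity>\<close>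
      amp_powr_summable[OF assms(4) Ck per assms(1,2)], folded frac_laplacian_series[OF assms(4) Ck per assms(1,2)]]
  have pos: "0 \<le> ?D" and le: "gauss_moment \<alpha> * ?I \<le> gauss_gap \<alpha> * ennreal ?D"
    using lower assms(12) by simp_all
  have "gauss_gap \<alpha> * (ennreal c * ?I) \<le> gauss_moment \<alpha> * ?I"
    using mult_right_mono[OF kc, of ?I] by (simp add: mult_ac)
  also note le
  finally have "ennreal c * ?I \<le> ennreal ?D"
    using gauss_gap_pos[of \<alpha>] \<open>gauss_gap \<alpha> < \<infinity>\<close> by (subst (asm) ennreal_mult_le_mult_iff) auto
  then have "enn2ereal (ennreal c * ?I) \<le> ereal ?D"
    using pos by (metis enn2ereal_ennreal less_eq_ennreal.rep_eq)
  then show ?thesis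
    unfolding dissipation_eq[OF moc \<open>0 < \<xi>\<close> \<open>0 < c\<close>]
    by (metis ereal_minus_le_minus minus_diff_eq uminus_ereal.simps(1) uminus_add_conv_diff add.commute diff_conv_add_uminus)
qed

end
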